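(* Let $f(x;\theta)=\nu(x)\exp\{\theta^Ts(x)-\psi(\theta)\}$, $x\in\mathcal X$, $\theta\in\Theta$, be an exponential family satisfying Amari's regularity conditions (listed in the context). Further, assume that $s$ is uniformly continuous on $\mathcal X$ and that $s(\mathcal X)$ is compact. Then, for any $\epsilon>0$, there exists a finite measurable partition $\{B_k\}_{k=0}^{K(\epsilon)}$ of $\mathcal X$ such that, for all choices of bin labels $s_k\in s(B_k)$, all terms of Amari's information geometry for $f(x;\theta)$ can be approximated to $O(\epsilon)$ by the corresponding terms for the discretised family $\left\{(\pi_k(\theta),s_k) : \pi_k(\theta)=\int_{B_k}f(x;\theta)\,dx,\ s_k\in s(B_k)\right\}$. In particular: (a) For all $\theta$, and any norm, $\|\mu_d(\theta)-\mu_c(\theta)\|=O(\epsilon)$, where $\mu_d(\theta)=\sum_{k=0}^{K(\epsilon)}s_k\pi_k(\theta)$ and $\mu_c(\theta)=\int_{\mathcal X}s(x)f(x;\theta)\,dx$. (b) The expected Fisher information $I_c(\theta)$ for $\theta$ of $f(x;\theta)$ and the expected Fisher information $I_d(\theta)$ of $\{\pi_k(\theta)\}$ satisfy $\|I_d(\theta)-I_c(\theta)\|_\infty=O(\epsilon^2)$. (c) The skewness tensors $T_c(\theta)$ of $f(x;\theta)$ and $T_d(\theta)$ of $\{\pi_k(\theta)\}$ satisfy $\|T_d(\theta)-T_c(\theta)\|_\infty=O(\epsilon^3)$.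
   Context: $\mathcal X$ is a subset of a Euclidean space with Lebesgue measure $dx$, $s:\mathcal X\to\mathbb R^p$, $\Theta\subset\mathbb R^p$, and $\psi$ is the log-normaliser. The $O(\cdot)$ statements are as $\epsilon\to0$, and $\|\cdot\|_\infty$ is the maximum absolute value of the entries. Amari's regularity conditions, for a family of densities $f(x;\theta)$ with log-density $\ell(x;\theta)=\log f(x;\theta)$, are: (1) all $f(\cdot;\theta)$ have a common support, with $f(x;\theta)>0$ for all $x$ in this support; (2) for every fixed $\theta$, the functions $x\mapsto\frac{\partial\ell}{\partial\theta_r}(x;\theta)$ are linearly independent; (3) moments of the random variables $\frac{\partial\ell}{\partial\theta_r}(X;\theta)$ exist up to all necessary orders; (4) partial differentiation with respect to $\theta$ and integration with respect to $x$ can be interchanged for the functions considered. For a parametric family of distributions with log-density or log-probability function $\ell(\cdot;\theta)$, write $\partial_r=\partial/\partial\theta_r$. The Fisher information has entries $E_\theta[\partial_r\ell\,\partial_s\ell]$. The skewness tensor has entries $T_{rst}(\theta)=E_\theta[\partial_r\ell\,\partial_s\ell\,\partial_t\ell]$. For the discretised family, $\ell$ at bin $k$ is $\log\pi_k(\theta)$. The terms of Amari's information geometry are the mean parameter, the Fisher information, the skewness tensor, and the $\alpha$-connection coefficients $E_\theta[\partial_r\partial_s\ell\,\partial_t\ell]+\frac{1-\alpha}{2}T_{rst}$. *)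

theory Defs
  imports "HOL-Analysis.Analysis" "HOL-Library.Landau_Symbols"
begin

definition partial :: "'p \<Rightarrow> (real ^ 'p \<Rightarrow> real) \<Rightarrow> real ^ 'p \<Rightarrow> real" where
  "partial r g \<theta> = deriv (\<lambda>h. g (\<theta> + h *\<^sub>R axis r 1)) 0"

text \<open>
  Parametric families are given by a reference measure \<open>M\<close> and a density \<open>p \<theta> x\<close> with respect
  to \<open>M\<close>, the parameter coming first. The same definitions thus serve a Lebesgue density on a
  set \<open>X\<close> (\<open>M = lebesgue_on X\<close>) and a probability function on the bins \<open>0, \<dots>, K\<close>
  (\<open>M = count_space {..K}\<close>, where integrals are sums over \<open>k \<le> K\<close>). Points \<open>x\<close> with
  \<open>p \<theta> x = 0\<close> do not contribute to an expectation, so the value of \<open>ln 0\<close> is immaterial.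
\<close>

definition expect ::
    "'b measure \<Rightarrow> (real ^ 'p \<Rightarrow> 'b \<Rightarrow> real) \<Rightarrow> real ^ 'p \<Rightarrow> ('b \<Rightarrow> 'v) \<Rightarrow> 'v::euclidean_space" where
  "expect M p \<theta> g = (\<integral>x. p \<theta> x *\<^sub>R g x \<partial>M)"

definition loglik :: "(real ^ 'p \<Rightarrow> 'b \<Rightarrow> real) \<Rightarrow> 'b \<Rightarrow> real ^ 'p \<Rightarrow> real" where
  "loglik p x \<theta> = ln (p \<theta> x)"

definition fisher_information ::
    "'b measure \<Rightarrow> (real ^ 'p \<Rightarrow> 'b \<Rightarrow> real) \<Rightarrow> real ^ 'p \<Rightarrow> real ^ 'p ^ 'p" where
  "fisher_information M p \<theta> =
     (\<chi> r s. expect M p \<theta> (\<lambda>x. partial r (loglik p x) \<theta> * partial s (loglik p x) \<theta>))"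

definition skewness_tensor ::
    "'b measure \<Rightarrow> (real ^ 'p \<Rightarrow> 'b \<Rightarrow> real) \<Rightarrow> real ^ 'p \<Rightarrow> real ^ 'p ^ 'p ^ 'p" where
  "skewness_tensor M p \<theta> =
     (\<chi> r s t. expect M p \<theta> (\<lambda>x. partial r (loglik p x) \<theta> * partial s (loglik p x) \<theta>
                                  * partial t (loglik p x) \<theta>))"

definition alpha_connection ::
    "real \<Rightarrow> 'b measure \<Rightarrow> (real ^ 'p \<Rightarrow> 'b \<Rightarrow> real) \<Rightarrow> real ^ 'p \<Rightarrow> real ^ 'p ^ 'p ^ 'p" where
  "alpha_connection \<alpha> M p \<theta> =
     (\<chi> r s t. expect M p \<theta> (\<lambda>x. partial r (partial s (loglik p x)) \<theta> * partial t (loglik p x) \<theta>)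
               + (1 - \<alpha>) / 2 * skewness_tensor M p \<theta> $ r $ s $ t)"

definition log_normaliser ::
    "'a::euclidean_space set \<Rightarrow> ('a \<Rightarrow> real) \<Rightarrow> ('a \<Rightarrow> real ^ 'p) \<Rightarrow> real ^ 'p \<Rightarrow> real" where
  "log_normaliser X \<nu> s \<theta> = ln (\<integral>x. \<nu> x * exp (\<theta> \<bullet> s x) \<partial>lebesgue_on X)"

text \<open>
  The density is defined for all \<open>\<theta>\<close>, not only for \<open>\<theta> \<in> \<Theta>\<close>, so partial derivatives at a
  point of \<open>\<Theta>\<close> make sense without assuming \<open>\<Theta>\<close> open. (If \<open>s\<close> is bounded on \<open>X\<close> and the
  normalising integral is finite for one \<open>\<theta>\<close>, it is finite for all.)
\<close>

definition expfam_density ::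
    "'a::euclidean_space set \<Rightarrow> ('a \<Rightarrow> real) \<Rightarrow> ('a \<Rightarrow> real ^ 'p) \<Rightarrow> real ^ 'p \<Rightarrow> 'a \<Rightarrow> real" where
  "expfam_density X \<nu> s \<theta> x = \<nu> x * exp (\<theta> \<bullet> s x - log_normaliser X \<nu> s \<theta>)"

definition exponential_family ::
    "'a::euclidean_space set \<Rightarrow> (real ^ 'p) set \<Rightarrow> ('a \<Rightarrow> real) \<Rightarrow> ('a \<Rightarrow> real ^ 'p) \<Rightarrow> bool" where
  "exponential_family X \<Theta> \<nu> s \<longleftrightarrow>
     X \<in> sets lebesgue \<and> X \<noteq> {} \<and>
     \<nu> \<in> borel_measurable (lebesgue_on X) \<and> (\<forall>x\<in>X. 0 \<le> \<nu> x) \<and>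
     s \<in> borel_measurable (lebesgue_on X) \<and>
     (\<forall>\<theta>\<in>\<Theta>. integrable (lebesgue_on X) (expfam_density X \<nu> s \<theta>) \<and>
            (\<integral>x. expfam_density X \<nu> s \<theta> x \<partial>lebesgue_on X) = 1)"

definition interchangeable ::
    "'b measure \<Rightarrow> (real ^ 'p \<Rightarrow> 'b \<Rightarrow> real) \<Rightarrow> real ^ 'p \<Rightarrow> bool" where
  "interchangeable M g \<theta> \<longleftrightarrow>
     (\<forall>r. integrable M (\<lambda>x. partial r (\<lambda>\<eta>. g \<eta> x) \<theta>) \<and>
          ((\<lambda>h. \<integral>x. g (\<theta> + h *\<^sub>R axis r 1) x \<partial>M) has_real_derivative
           (\<integral>x. partial r (\<lambda>\<eta>. g \<eta> x) \<theta> \<partial>M)) (at 0))"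

text \<open>
  Amari's regularity conditions. The moments needed for the skewness tensor are the joint moments
  of order at most three. The functions to which differentiation under the integral sign is
  applied are the density and its first partial derivatives, integrated over the whole space (for
  the family itself) or over a bin (for its discretisations).
\<close>

definition amari_regular ::
    "'b measure \<Rightarrow> (real ^ 'p) set \<Rightarrow> (real ^ 'p \<Rightarrow> 'b \<Rightarrow> real) \<Rightarrow> bool" where
  "amari_regular M \<Theta> p \<longleftrightarrow>
     (\<exists>S. \<forall>\<theta>\<in>\<Theta>. {x \<in> space M. p \<theta> x \<noteq> 0} = S \<and> (\<forall>x\<in>S. 0 < p \<theta> x)) \<and>
     (\<forall>\<theta>\<in>\<Theta>. \<forall>c :: real ^ 'p.
        (\<forall>x\<in>space M. p \<theta> x \<noteq> 0 \<longrightarrow> (\<Sum>r\<in>UNIV. c $ r * partial r (loglik p x) \<theta>) = 0) \<longrightarrow> c = 0) \<and>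
     (\<forall>\<theta>\<in>\<Theta>. \<forall>rs :: 'p list. length rs \<le> 3 \<longrightarrow>
        integrable M (\<lambda>x. p \<theta> x * (\<Prod>r\<leftarrow>rs. partial r (loglik p x) \<theta>))) \<and>
     (\<forall>\<theta>\<in>\<Theta>. \<forall>B\<in>sets M.
        interchangeable (restrict_space M B) p \<theta> \<and>
        (\<forall>t. interchangeable (restrict_space M B) (\<lambda>\<eta> x. partial t (\<lambda>\<zeta>. p \<zeta> x) \<eta>) \<theta>))"

definition finite_measurable_partition ::
    "'a::euclidean_space set \<Rightarrow> nat \<Rightarrow> (nat \<Rightarrow> 'a set) \<Rightarrow> bool" where
  "finite_measurable_partition X K B \<longleftrightarrow>
     (\<forall>k\<le>K. B k \<in> sets lebesgue \<and> B k \<noteq> {}) \<and> disjoint_family_on B {..K} \<and> (\<Union>k\<le>K. B k) = X"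

definition bin_prob ::
    "(nat \<Rightarrow> 'a::euclidean_space set) \<Rightarrow> (real ^ 'p \<Rightarrow> 'a \<Rightarrow> real) \<Rightarrow> real ^ 'p \<Rightarrow> nat \<Rightarrow> real" where
  "bin_prob B f \<theta> k = (\<integral>x. f \<theta> x \<partial>lebesgue_on (B k))"

definition is_norm :: "('v::real_vector \<Rightarrow> real) \<Rightarrow> bool" where
  "is_norm N \<longleftrightarrow>
     (\<forall>x. N x = 0 \<longleftrightarrow> x = 0) \<and> (\<forall>c x. N (c *\<^sub>R x) = \<bar>c\<bar> * N x) \<and> (\<forall>x y. N (x + y) \<le> N x + N y)"

text \<open>
  On the types \<open>real ^ 'p ^ 'p\<close> and \<open>real ^ 'p ^ 'p ^ 'p\<close> the standard basis consists of the unit arrays,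
  so the library's \<open>infnorm\<close> is the maximum absolute value of the entries.
\<close>

end

theory Submission
  imports Defs
begin

text \<open>
  For a bin \<open>B\<close> the score of the discretised family is the conditional mean of \<open>s\<close> on \<open>B\<close> minus the
  mean of \<open>s\<close>, and its second derivatives are the conditional covariance minus the covariance. If
  \<open>s\<close> oscillates by at most \<open>\<delta>\<close> on every bin, these differ from the score \<open>s x - \<mu>\<close> and from minus
  the covariance by \<open>O(\<delta>)\<close> on the bin, so every expectation involved changes by \<open>O(\<delta>)\<close>. At a
  fixed bin width the skewness error is in general only quadratic, because of the cross term between
  conditional means and conditional covariances; since the number of bins for a given
  \<open>\<epsilon>\<close> is free, the bins are chosen with \<open>\<delta> = \<epsilon>\<^sup>3\<close>, which gives all the rates at once. All
  derivatives exist at every parameter since \<open>s\<close> is bounded.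
\<close>

section \<open>Differentiation of integrals of exponentials\<close>

text \<open>Both sides come from \<open>1 + y \<le> exp y\<close>, used at \<open>y\<close> and at
  \<open>- y\<close>. The constant is not the best one; what matters later is that the remainder is
  quadratic.\<close>

lemma exp_remainder_bound:
  fixes y :: real
  shows "\<bar>exp y - 1 - y\<bar> \<le> y\<^sup>2 * exp \<bar>y\<bar>"
proof -
  have lower: "1 + y \<le> exp y" by (rule exp_ge_add_one_self)
  have "(1 - y) * exp y \<le> exp (- y) * exp y"
    using exp_ge_add_one_self[of "- y"] by (intro mult_right_mono) auto
  then have upper: "exp y - 1 \<le> y * exp y"
    by (simp add: exp_minus algebra_simps)
  show ?thesis
  proof (cases "0 \<le> y")
    case True
    have "exp y - 1 - y \<le> y * (exp y - 1)"
      using upper by (simp add: algebra_simps)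
    also have "\<dots> \<le> y * (y * exp y)"
      using upper True by (rule mult_left_mono)
    finally have "exp y - 1 - y \<le> y\<^sup>2 * exp \<bar>y\<bar>"
      using True by (simp add: power2_eq_square mult.assoc)
    then show ?thesis
      using lower by linarith
  next
    case False
    have "exp y - 1 - y \<le> (- y) * (1 - exp y)"
      using upper by (simp add: algebra_simps)
    also have "\<dots> \<le> (- y) * (- y)"
      using lower False by (intro mult_left_mono) linarith+
    also have "\<dots> \<le> y\<^sup>2 * exp \<bar>y\<bar>"
      using mult_left_mono[of 1 "exp \<bar>y\<bar>" "y\<^sup>2"] by (simp add: power2_eq_square)
    finally show ?thesis using lower by linarith
  qed
qed

lemma norm_integral_le_integral:
  fixes f :: "'b \<Rightarrow> 'v::euclidean_space"
  assumes "integrable M f" "integrable M g" "\<And>x. x \<in> space M \<Longrightarrow> norm (f x) \<le> g x"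
  shows "norm (\<integral>x. f x \<partial>M) \<le> (\<integral>x. g x \<partial>M)"
proof -
  have "norm (\<integral>x. f x \<partial>M) \<le> (\<integral>x. norm (f x) \<partial>M)"
    by (rule Bochner_Integration.integral_norm_bound)
  also have "\<dots> \<le> (\<integral>x. g x \<partial>M)"
    using assms by (intro Bochner_Integration.integral_mono) auto
  finally show ?thesis .
qed

lemma integrable_mult_bounded:
  fixes m g :: "'b \<Rightarrow> real"
  assumes m: "integrable M m" and g: "g \<in> borel_measurable M"
    and bd: "\<And>x. x \<in> space M \<Longrightarrow> \<bar>g x\<bar> \<le> D"
  shows "integrable M (\<lambda>x. m x * g x)"
proof (rule Bochner_Integration.integrable_bound)
  show "integrable M (\<lambda>x. D * m x)"
    using m by simp
  show "(\<lambda>x. m x * g x) \<in> borel_measurable M"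
    by (rule borel_measurable_times[OF borel_measurable_integrable[OF m] g])
  show "AE x in M. norm (m x * g x) \<le> norm (D * m x)"
  proof (rule AE_I2)
    fix x assume "x \<in> space M"
    then have "\<bar>g x\<bar> \<le> \<bar>D\<bar>" using bd[of x] by linarith
    from mult_left_mono[OF this, of "\<bar>m x\<bar>"]
    show "norm (m x * g x) \<le> norm (D * m x)" by (simp add: abs_mult mult.commute)
  qed
qed

text \<open>With \<open>z\<close> bounded, the quadratic remainder of \<open>exp\<close> is uniform
  in the integration variable, so the difference quotient misses its limit by at most
  \<open>\<bar>h\<bar> * A\<close>. No limit theorem for integrals enters.\<close>

lemma has_real_derivative_integral_exp:
  fixes m z :: "'b \<Rightarrow> real"
  assumes m: "integrable M m" and z: "z \<in> borel_measurable M"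
    and bd: "\<And>x. x \<in> space M \<Longrightarrow> \<bar>z x\<bar> \<le> C"
  shows "((\<lambda>h. \<integral>x. m x * exp (h * z x) \<partial>M) has_real_derivative (\<integral>x. m x * z x \<partial>M)) (at 0)"
proof -
  have int_exp: "integrable M (\<lambda>x. m x * exp (h * z x))" for h
  proof (rule integrable_mult_bounded[OF m])
    show "(\<lambda>x. exp (h * z x)) \<in> borel_measurable M"
      using z by measurable
    fix x assume "x \<in> space M"
    then have "h * z x \<le> \<bar>h\<bar> * C"
      using mult_left_mono[OF bd[of x], of "\<bar>h\<bar>"] abs_ge_self[of "h * z x"] by (simp add: abs_mult)
    then show "\<bar>exp (h * z x)\<bar> \<le> exp (\<bar>h\<bar> * C)" by simp
  qed
  have int_z: "integrable M (\<lambda>x. m x * z x)"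
    by (rule integrable_mult_bounded[OF m z bd])
  define A where "A = C\<^sup>2 * exp C * (\<integral>x. \<bar>m x\<bar> \<partial>M)"
  let ?F = "\<lambda>h. \<integral>x. m x * exp (h * z x) \<partial>M" and ?D = "\<integral>x. m x * z x \<partial>M"
  \<comment> \<open>The restriction \<open>\<bar>h\<bar> \<le> 1\<close> keeps
    \<open>\<bar>h * z x\<bar>\<close> below \<open>C\<close>, so that the exponential factor of the
    remainder is at most \<open>exp C\<close> for all these \<open>h\<close>.\<close>
  have bound: "\<bar>(?F h - ?F 0) / h - ?D\<bar> \<le> \<bar>h\<bar> * A" if h: "h \<noteq> 0" "\<bar>h\<bar> \<le> 1" for h
  proof -
    have "?F h - ?F 0 - h * ?D = (\<integral>x. m x * (exp (h * z x) - 1 - h * z x) \<partial>M)"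
    proof -
      have "(\<integral>x. m x * (exp (h * z x) - 1 - h * z x) \<partial>M)
            = (\<integral>x. m x * exp (h * z x) - m x - h * (m x * z x) \<partial>M)"
        by (intro Bochner_Integration.integral_cong) (auto simp: algebra_simps)
      also have "\<dots> = ?F h - ?F 0 - h * ?D"
        using int_exp[of h] int_z m by simp
      finally show ?thesis by simp
    qed
    also have "\<bar>\<dots>\<bar> \<le> (\<integral>x. h\<^sup>2 * (C\<^sup>2 * exp C) * \<bar>m x\<bar> \<partial>M)"
      unfolding real_norm_def[symmetric]
    proof (rule norm_integral_le_integral)
      have "integrable M (\<lambda>x. m x * exp (h * z x) - m x - h * (m x * z x))"
        using int_exp[of h] int_z m by auto
      then show "integrable M (\<lambda>x. m x * (exp (h * z x) - 1 - h * z x))"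
        by (simp add: algebra_simps)
      show "integrable M (\<lambda>x. h\<^sup>2 * (C\<^sup>2 * exp C) * norm (m x))"
        using m by auto
      fix x assume x: "x \<in> space M"
      have C: "\<bar>z x\<bar> \<le> C" using bd[OF x] .
      have hz: "\<bar>h * z x\<bar> \<le> C"
        using mult_mono[OF h(2) C] by (simp add: abs_mult)
      have "\<bar>exp (h * z x) - 1 - h * z x\<bar> \<le> (h * z x)\<^sup>2 * exp \<bar>h * z x\<bar>"
        by (rule exp_remainder_bound)
      also have "\<dots> \<le> (h\<^sup>2 * C\<^sup>2) * exp C"
      proof (rule mult_mono)
        show "(h * z x)\<^sup>2 \<le> h\<^sup>2 * C\<^sup>2"
          using C abs_le_square_iff[of "z x" C] by (simp add: power_mult_distrib mult_left_mono)
      qed (use hz in auto)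
      finally have "\<bar>m x\<bar> * \<bar>exp (h * z x) - 1 - h * z x\<bar> \<le> \<bar>m x\<bar> * ((h\<^sup>2 * C\<^sup>2) * exp C)"
        by (rule mult_left_mono) simp
      then show "norm (m x * (exp (h * z x) - 1 - h * z x)) \<le> h\<^sup>2 * (C\<^sup>2 * exp C) * norm (m x)"
        unfolding real_norm_def abs_mult by (simp only: mult_ac)
    qed
    also have "\<dots> = h\<^sup>2 * A" by (simp add: A_def)
    finally have le: "\<bar>?F h - ?F 0 - h * ?D\<bar> \<le> h\<^sup>2 * A" .
    have "(?F h - ?F 0) / h - ?D = (?F h - ?F 0 - h * ?D) / h"
      using h(1) by (simp add: diff_divide_distrib)
    also have "\<bar>\<dots>\<bar> \<le> h\<^sup>2 * A / \<bar>h\<bar>"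
      using le by (simp only: abs_divide divide_right_mono abs_ge_zero)
    also have "h\<^sup>2 * A / \<bar>h\<bar> = \<bar>h\<bar> * A"
      using h(1) by (simp add: power2_eq_square field_simps)
    finally show ?thesis .
  qed
  show ?thesis
    unfolding DERIV_def
  proof (rule LIM_zero_cancel, rule Lim_null_comparison)
    show "\<forall>\<^sub>F h in at 0. norm ((?F (0 + h) - ?F 0) / h - ?D) \<le> \<bar>h\<bar> * A"
      unfolding eventually_at by (rule exI[of _ 1]) (use bound in auto)
    show "((\<lambda>h::real. \<bar>h\<bar> * A) \<longlongrightarrow> 0) (at 0)"
      by (auto intro!: tendsto_eq_intros)
  qed
qed

section \<open>Exponentially tilted measures\<close>

text \<open>An unnormalised moment. Divided by the case \<open>g = 1\<close> it is the expectation
  of \<open>g\<close> under the normalised family; when \<open>M\<close> is a bin instead of the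
  whole space, it is the conditional expectation given the bin.\<close>

definition tilt ::
    "'b measure \<Rightarrow> ('b \<Rightarrow> real) \<Rightarrow> ('b \<Rightarrow> real ^ 'p) \<Rightarrow> ('b \<Rightarrow> real) \<Rightarrow> real ^ 'p \<Rightarrow> real" where
  "tilt M \<nu> s g \<eta> = (\<integral>x. \<nu> x * g x * exp (\<eta> \<bullet> s x) \<partial>M)"

definition tilt_mean ::
    "'b measure \<Rightarrow> ('b \<Rightarrow> real) \<Rightarrow> ('b \<Rightarrow> real ^ 'p) \<Rightarrow> 'p \<Rightarrow> real ^ 'p \<Rightarrow> real" where
  "tilt_mean M \<nu> s r \<eta> = tilt M \<nu> s (\<lambda>x. s x $ r) \<eta> / tilt M \<nu> s (\<lambda>_. 1) \<eta>"

text \<open>Here \<open>r\<close> is the direction of differentiation and \<open>t\<close> the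
  component of the mean; the factors stand in the order in which the quotient rule yields
  them.\<close>

definition tilt_cov ::
    "'b measure \<Rightarrow> ('b \<Rightarrow> real) \<Rightarrow> ('b \<Rightarrow> real ^ 'p) \<Rightarrow> 'p \<Rightarrow> 'p \<Rightarrow> real ^ 'p \<Rightarrow> real" where
  "tilt_cov M \<nu> s r t \<eta> =
     tilt M \<nu> s (\<lambda>x. s x $ t * s x $ r) \<eta> / tilt M \<nu> s (\<lambda>_. 1) \<eta>
     - tilt_mean M \<nu> s t \<eta> * tilt_mean M \<nu> s r \<eta>"

text \<open>The conditions concern the base \<open>\<nu>\<close> alone. As \<open>s\<close> is
  bounded, for each parameter the tilting factor lies between two positive constants, so
  integrability and positive mass carry over to every parameter.\<close>

locale exponential_tilt =
  fixes M :: "'b measure" and \<nu> :: "'b \<Rightarrow> real" and s :: "'b \<Rightarrow> real ^ 'p" and C :: real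
  assumes nonneg: "\<And>x. x \<in> space M \<Longrightarrow> 0 \<le> \<nu> x"
    and integrable_base: "integrable M \<nu>"
    and base_pos: "0 < (\<integral>x. \<nu> x \<partial>M)"
    and measurable_stat [measurable]: "s \<in> borel_measurable M"
    and bound: "\<And>x. x \<in> space M \<Longrightarrow> norm (s x) \<le> C"
begin

lemma comp_measurable [measurable]: "(\<lambda>x. s x $ r) \<in> borel_measurable M"
proof -
  have "(\<lambda>x. s x $ r) = (\<lambda>x. s x \<bullet> axis r 1)"
    by (simp add: inner_axis)
  then show ?thesis by simp
qed

lemma comp_bound: "x \<in> space M \<Longrightarrow> \<bar>s x $ r\<bar> \<le> C"
  using bound[of x] component_le_norm_cart[of "s x" r] by linarith

lemma bound_nonneg: "0 \<le> C"
proof -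
  \<comment> \<open>A space without points would give the integral zero.\<close>
  have "space M \<noteq> {}"
    using base_pos Bochner_Integration.integral_empty[of M \<nu>] by (metis less_irrefl)
  then show ?thesis using bound norm_ge_zero order_trans by blast
qed

lemma exponent_bound: "x \<in> space M \<Longrightarrow> \<bar>\<eta> \<bullet> s x\<bar> \<le> norm \<eta> * C"
  using Cauchy_Schwarz_ineq2[of \<eta> "s x"] mult_left_mono[OF bound[of x], of "norm \<eta>"] by force

lemma integrable_tilt:
  assumes g [measurable]: "g \<in> borel_measurable M"
    and gb: "\<And>x. x \<in> space M \<Longrightarrow> \<bar>g x\<bar> \<le> D"
  shows "integrable M (\<lambda>x. \<nu> x * g x * exp (\<eta> \<bullet> s x))"
proof -
  have "integrable M (\<lambda>x. \<nu> x * (g x * exp (\<eta> \<bullet> s x)))"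
  proof (rule integrable_mult_bounded[OF integrable_base])
    fix x assume x: "x \<in> space M"
    show "\<bar>g x * exp (\<eta> \<bullet> s x)\<bar> \<le> D * exp (norm \<eta> * C)"
      unfolding abs_mult using gb[OF x] exponent_bound[OF x, of \<eta>] by (intro mult_mono) auto
  qed measurable
  then show ?thesis by (simp add: mult.assoc)
qed

text \<open>The tilting factor is at least \<open>exp (- (norm \<eta> * C))\<close>, so a positive
  multiple of the base mass survives.\<close>

lemma tilt_one_pos: "0 < tilt M \<nu> s (\<lambda>_. 1) \<eta>"
proof -
  have "0 < exp (- (norm \<eta> * C)) * (\<integral>x. \<nu> x \<partial>M)"
    using base_pos by simp
  also have "\<dots> = (\<integral>x. exp (- (norm \<eta> * C)) * \<nu> x \<partial>M)" by simp
  also have "\<dots> \<le> tilt M \<nu> s (\<lambda>_. 1) \<eta>"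
    unfolding tilt_def
  proof (rule integral_mono)
    show "integrable M (\<lambda>x. \<nu> x * 1 * exp (\<eta> \<bullet> s x))"
      by (rule integrable_tilt[where D = 1]) auto
    fix x assume x: "x \<in> space M"
    show "exp (- (norm \<eta> * C)) * \<nu> x \<le> \<nu> x * 1 * exp (\<eta> \<bullet> s x)"
      using exponent_bound[OF x, of \<eta>] nonneg[OF x]
      by (subst mult.commute) (auto intro!: mult_left_mono)
  qed (use integrable_base in simp)
  finally show ?thesis .
qed

lemma has_real_derivative_tilt:
  assumes g [measurable]: "g \<in> borel_measurable M"
    and gb: "\<And>x. x \<in> space M \<Longrightarrow> \<bar>g x\<bar> \<le> D"
  shows "((\<lambda>h. tilt M \<nu> s g (\<eta> + h *\<^sub>R axis r 1)) has_real_derivative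
           tilt M \<nu> s (\<lambda>x. g x * s x $ r) \<eta>) (at 0)"
proof -
  \<comment> \<open>A shift along \<open>axis r 1\<close> multiplies the integrand by
    \<open>exp (h * s x $ r)\<close>; everything else is the fixed weight \<open>m\<close> of
    \<open>has_real_derivative_integral_exp\<close>.\<close>
  have "((\<lambda>h. \<integral>x. (\<nu> x * g x * exp (\<eta> \<bullet> s x)) * exp (h * s x $ r) \<partial>M) has_real_derivative
          (\<integral>x. (\<nu> x * g x * exp (\<eta> \<bullet> s x)) * s x $ r \<partial>M)) (at 0)"
    by (rule has_real_derivative_integral_exp[OF integrable_tilt[OF g gb] comp_measurable comp_bound])
  then show ?thesis
    by (simp add: tilt_def inner_add_left inner_axis' exp_add mult_ac)
qed

lemma has_real_derivative_ln_tilt: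
  "((\<lambda>h. ln (tilt M \<nu> s (\<lambda>_. 1) (\<eta> + h *\<^sub>R axis r 1))) has_real_derivative tilt_mean M \<nu> s r \<eta>) (at 0)"
  using DERIV_chain2[OF DERIV_ln_divide has_real_derivative_tilt[of "\<lambda>_. 1" 1 \<eta> r]] tilt_one_pos[of \<eta>]
  by (simp add: tilt_mean_def)

lemma has_real_derivative_tilt_mean:
  "((\<lambda>h. tilt_mean M \<nu> s t (\<eta> + h *\<^sub>R axis r 1)) has_real_derivative tilt_cov M \<nu> s r t \<eta>) (at 0)"
proof -
  have "((\<lambda>h. tilt_mean M \<nu> s t (\<eta> + h *\<^sub>R axis r 1)) has_real_derivative
      (tilt M \<nu> s (\<lambda>x. s x $ t * s x $ r) \<eta> * tilt M \<nu> s (\<lambda>_. 1) \<eta>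
        - tilt M \<nu> s (\<lambda>x. s x $ t) \<eta> * tilt M \<nu> s (\<lambda>x. s x $ r) \<eta>)
       / (tilt M \<nu> s (\<lambda>_. 1) \<eta> * tilt M \<nu> s (\<lambda>_. 1) \<eta>)) (at 0)"
    using DERIV_divide[OF has_real_derivative_tilt[OF comp_measurable[of t] comp_bound, of \<eta> r]
        has_real_derivative_tilt[of "\<lambda>_. 1" 1 \<eta> r]] tilt_one_pos[of \<eta>]
    by (simp add: tilt_mean_def)
  moreover have "tilt M \<nu> s (\<lambda>_. 1) \<eta> \<noteq> 0" using tilt_one_pos[of \<eta>] by simp
  ultimately show ?thesis
    by (simp add: tilt_cov_def tilt_mean_def diff_divide_distrib)
qed

text \<open>A normalised tilt is an average with nonnegative weights, so it cannot leave an interval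
  that contains all the averaged values. The estimates on bins rest on this.\<close>

lemma tilt_average_close:
  assumes g [measurable]: "g \<in> borel_measurable M"
    and gb: "\<And>x. x \<in> space M \<Longrightarrow> \<bar>g x - a\<bar> \<le> \<delta>"
  shows "\<bar>tilt M \<nu> s g \<eta> / tilt M \<nu> s (\<lambda>_. 1) \<eta> - a\<bar> \<le> \<delta>"
proof -
  have ig: "integrable M (\<lambda>x. \<nu> x * g x * exp (\<eta> \<bullet> s x))"
    by (rule integrable_tilt[OF g, of "\<bar>a\<bar> + \<delta>"]) (use gb in \<open>force\<close>)
  have i1: "integrable M (\<lambda>x. \<nu> x * exp (\<eta> \<bullet> s x))"
    using integrable_tilt[of "\<lambda>_. 1" 1 \<eta>] by simp
  have "tilt M \<nu> s g \<eta> - a * tilt M \<nu> s (\<lambda>_. 1) \<eta>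
        = (\<integral>x. \<nu> x * g x * exp (\<eta> \<bullet> s x) - a * (\<nu> x * exp (\<eta> \<bullet> s x)) \<partial>M)"
    using ig i1 by (simp add: tilt_def)
  also have "\<bar>\<dots>\<bar> \<le> (\<integral>x. \<delta> * (\<nu> x * exp (\<eta> \<bullet> s x)) \<partial>M)"
    unfolding real_norm_def[symmetric]
  proof (rule norm_integral_le_integral)
    fix x assume x: "x \<in> space M"
    have "\<nu> x * g x * exp (\<eta> \<bullet> s x) - a * (\<nu> x * exp (\<eta> \<bullet> s x))
          = (g x - a) * (\<nu> x * exp (\<eta> \<bullet> s x))"
      by (simp add: algebra_simps)
    then show "norm (\<nu> x * g x * exp (\<eta> \<bullet> s x) - a * (\<nu> x * exp (\<eta> \<bullet> s x)))
          \<le> \<delta> * (\<nu> x * exp (\<eta> \<bullet> s x))"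
      using mult_right_mono[OF gb[OF x], of "\<nu> x * exp (\<eta> \<bullet> s x)"] nonneg[OF x]
      by (simp add: abs_mult)
  qed (use ig i1 in auto)
  also have "\<dots> = \<delta> * tilt M \<nu> s (\<lambda>_. 1) \<eta>" by (simp add: tilt_def)
  finally have le: "\<bar>tilt M \<nu> s g \<eta> - a * tilt M \<nu> s (\<lambda>_. 1) \<eta>\<bar> \<le> \<delta> * tilt M \<nu> s (\<lambda>_. 1) \<eta>" .
  have "tilt M \<nu> s g \<eta> / tilt M \<nu> s (\<lambda>_. 1) \<eta> - a
        = (tilt M \<nu> s g \<eta> - a * tilt M \<nu> s (\<lambda>_. 1) \<eta>) / tilt M \<nu> s (\<lambda>_. 1) \<eta>"
    using tilt_one_pos[of \<eta>] by (simp add: diff_divide_distrib)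
  then show ?thesis
    using le tilt_one_pos[of \<eta>] by (simp add: pos_divide_le_eq)
qed

lemma tilt_mean_close:
  assumes "\<And>x. x \<in> space M \<Longrightarrow> \<bar>s x $ r - a\<bar> \<le> \<delta>"
  shows "\<bar>tilt_mean M \<nu> s r \<eta> - a\<bar> \<le> \<delta>"
  unfolding tilt_mean_def by (rule tilt_average_close[OF comp_measurable assms])

lemma tilt_mean_bound: "\<bar>tilt_mean M \<nu> s r \<eta>\<bar> \<le> C"
  using tilt_mean_close[of r 0 C \<eta>] comp_bound by simp

text \<open>The covariance is the average of \<open>(s x $ r - m) * s x $ t\<close>, with \<open>m\<close> the mean of \<open>s x $ r\<close>.\<close>

lemma tilt_cov_bound:
  assumes "\<And>x y. x \<in> space M \<Longrightarrow> y \<in> space M \<Longrightarrow> \<bar>s x $ r - s y $ r\<bar> \<le> \<delta>"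
  shows "\<bar>tilt_cov M \<nu> s r t \<eta>\<bar> \<le> \<delta> * C"
proof -
  define m where "m = tilt_mean M \<nu> s r \<eta>"
  let ?Z = "tilt M \<nu> s (\<lambda>_. 1) \<eta>"
  \<comment> \<open>Each point of the space may serve as the centre in
    \<open>tilt_mean_close\<close>, so the mean is within \<open>\<delta>\<close> of every
    value.\<close>
  have m: "\<bar>s x $ r - m\<bar> \<le> \<delta>" if "x \<in> space M" for x
    using tilt_mean_close[of r "s x $ r" \<delta> \<eta>] assms[OF _ that] by (simp add: m_def abs_minus_commute)
  have i1: "integrable M (\<lambda>x. \<nu> x * (s x $ t * s x $ r) * exp (\<eta> \<bullet> s x))"
    by (rule integrable_tilt[of _ "C * C"])
       (auto simp: abs_mult intro!: mult_mono comp_bound bound_nonneg)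
  have i2: "integrable M (\<lambda>x. \<nu> x * s x $ t * exp (\<eta> \<bullet> s x))"
    by (rule integrable_tilt[OF comp_measurable comp_bound])
  have "tilt M \<nu> s (\<lambda>x. (s x $ r - m) * s x $ t) \<eta>
        = (\<integral>x. \<nu> x * (s x $ t * s x $ r) * exp (\<eta> \<bullet> s x) - m * (\<nu> x * s x $ t * exp (\<eta> \<bullet> s x)) \<partial>M)"
    unfolding tilt_def by (intro Bochner_Integration.integral_cong) (auto simp: algebra_simps)
  also have "\<dots> = tilt M \<nu> s (\<lambda>x. s x $ t * s x $ r) \<eta> - m * tilt M \<nu> s (\<lambda>x. s x $ t) \<eta>"
    using i1 i2 by (simp add: tilt_def)
  finally have "tilt_cov M \<nu> s r t \<eta> = tilt M \<nu> s (\<lambda>x. (s x $ r - m) * s x $ t) \<eta> / ?Z"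
    by (simp add: tilt_cov_def m_def tilt_mean_def[of M \<nu> s t] diff_divide_distrib)
  moreover have "\<bar>tilt M \<nu> s (\<lambda>x. (s x $ r - m) * s x $ t) \<eta> / ?Z - 0\<bar> \<le> \<delta> * C"
  proof (rule tilt_average_close)
    fix x assume x: "x \<in> space M"
    show "\<bar>(s x $ r - m) * s x $ t - 0\<bar> \<le> \<delta> * C"
      using mult_mono[OF m[OF x] comp_bound[OF x, of t]] m[OF x] by (simp add: abs_mult)
  qed measurable
  ultimately show ?thesis by simp
qed

end

section \<open>Finite partitions\<close>

text \<open>A compact image is totally bounded: finitely many balls of radius
  \<open>\<delta>/2\<close> cover it, and two points of one such ball are less than
  \<open>\<delta>\<close> apart. Their preimages are measurable; made disjoint and freed of empty
  sets, they are the bins.\<close>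

lemma small_image_partition:
  fixes X :: "'a::euclidean_space set" and s :: "'a \<Rightarrow> 'v::euclidean_space"
  assumes X: "X \<in> sets lebesgue" "X \<noteq> {}" and s: "s \<in> borel_measurable (lebesgue_on X)"
    and compact: "compact (s ` X)" and "0 < \<delta>"
  obtains K B where "finite_measurable_partition X K B"
    "\<And>k x y. k \<le> K \<Longrightarrow> x \<in> B k \<Longrightarrow> y \<in> B k \<Longrightarrow> dist (s x) (s y) \<le> \<delta>"
proof -
  obtain T where T: "finite T" "s ` X \<subseteq> (\<Union>c\<in>T. ball c (\<delta>/2))"
    using compact \<open>0 < \<delta>\<close> unfolding compact_eq_totally_bounded by (meson half_gt_zero)
  obtain c n where c: "T = c ` {i::nat. i < n}"
    using T(1) finite_imp_nat_seg_image_inj_on by metis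
  \<comment> \<open>Padding with the empty set turns the finite cover into a sequence, to which
    \<open>disjointed\<close> applies.\<close>
  define A where "A i = (if i < n then {x \<in> X. s x \<in> ball (c i) (\<delta>/2)} else {})" for i
  have A_sets: "A i \<in> sets lebesgue" for i
  proof -
    have "s -` ball (c i) (\<delta>/2) \<inter> space (lebesgue_on X) \<in> sets (lebesgue_on X)"
      using s by (rule measurable_sets) simp
    moreover have "s -` ball (c i) (\<delta>/2) \<inter> space (lebesgue_on X) = {x \<in> X. s x \<in> ball (c i) (\<delta>/2)}"
      by auto
    ultimately show ?thesis
      using X(1) by (simp add: A_def sets_restrict_space_iff)
  qed
  have UN_A: "(\<Union>i. A i) = X"
    using T(2) unfolding c A_def by (fastforce split: if_splits)
  \<comment> \<open>The empty set is removed so that every bin has a point from which a label can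
    come.\<close>
  define P where "P = disjointed A ` {..<n} - {{}}"
  have finP: "finite P" by (simp add: P_def)
  have disj_A: "disjointed A i \<subseteq> A i" for i by (rule disjointed_subset)
  have UN_P: "\<Union>P = X"
  proof -
    have "\<Union>P = (\<Union>i. disjointed A i)"
    proof
      show "(\<Union>i. disjointed A i) \<subseteq> \<Union>P"
      proof
        fix x assume "x \<in> (\<Union>i. disjointed A i)"
        then obtain i where i: "x \<in> disjointed A i" by blast
        then have "i < n" using disj_A[of i] by (auto simp: A_def split: if_splits)
        then show "x \<in> \<Union>P" using i by (auto simp: P_def)
      qed
    qed (auto simp: P_def)
    then show ?thesis using UN_A by (simp add: UN_disjointed_eq)
  qed
  have cardP: "card P \<noteq> 0" using finP UN_P X(2) by auto
  obtain B where B: "bij_betw B {0..<card P} P"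
    using ex_bij_betw_nat_finite[OF finP] by blast
  \<comment> \<open>\<open>K\<close> is the last index, not the number of bins; \<open>cardP\<close>
    ensures that the subtraction does not truncate.\<close>
  define K where "K = card P - 1"
  have idx: "{..K} = {0..<card P}" using cardP by (auto simp: K_def)
  have BP: "bij_betw B {..K} P" using B idx by simp
  have B_in: "B k \<in> P" if "k \<le> K" for k
    using BP that by (auto simp: bij_betw_def)
  have P_disj: "a \<inter> b = {}" if "a \<in> P" "b \<in> P" "a \<noteq> b" for a b
  proof -
    obtain i j where ij: "a = disjointed A i" "b = disjointed A j"
      using \<open>a \<in> P\<close> \<open>b \<in> P\<close> by (auto simp: P_def)
    then have "i \<noteq> j" using \<open>a \<noteq> b\<close> by auto
    then show ?thesis
      using disjoint_family_disjointed[of A] by (simp add: ij disjoint_family_on_def)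
  qed
  show ?thesis
  proof (rule that)
    show "finite_measurable_partition X K B"
      unfolding finite_measurable_partition_def
    proof (intro conjI allI impI)
      fix k assume "k \<le> K"
      from B_in[OF this] show "B k \<noteq> {}" by (simp add: P_def)
      have "range (disjointed A) \<subseteq> sets lebesgue"
        using A_sets by (intro sets.range_disjointed_sets) auto
      then show "B k \<in> sets lebesgue"
        using B_in[OF \<open>k \<le> K\<close>] by (auto simp: P_def)
    next
      show "disjoint_family_on B {..K}"
        unfolding disjoint_family_on_def
      proof (intro ballI impI)
        fix k l assume "k \<in> {..K}" "l \<in> {..K}" "k \<noteq> l"
        then show "B k \<inter> B l = {}"
          using BP by (intro P_disj B_in) (auto simp: bij_betw_def inj_on_def)
      qed
      show "(\<Union>k\<le>K. B k) = X"
        using BP UN_P by (simp add: bij_betw_def)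
    qed
    fix k x y assume k: "k \<le> K" and xy: "x \<in> B k" "y \<in> B k"
    obtain i where "B k \<subseteq> A i" using B_in[OF k] disj_A by (auto simp: P_def)
    then have "dist (c i) (s x) < \<delta>/2" "dist (c i) (s y) < \<delta>/2"
      using xy by (auto simp: A_def split: if_splits)
    then show "dist (s x) (s y) \<le> \<delta>"
      using dist_triangle3[of "s x" "s y" "c i"] by linarith
  qed
qed

lemma integrable_lebesgue_on_subset:
  fixes h :: "'a::euclidean_space \<Rightarrow> 'v::euclidean_space"
  assumes "integrable (lebesgue_on X) h" "X \<in> sets lebesgue" "A \<in> sets lebesgue" "A \<subseteq> X"
  shows "integrable (lebesgue_on A) h"
  using assms set_integrable_subset[of lebesgue X h A]
  by (simp add: integrable_restrict_space set_integrable_def)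

lemma integral_lebesgue_on_partition:
  fixes h :: "'a::euclidean_space \<Rightarrow> 'v::euclidean_space"
  assumes part: "finite_measurable_partition X K B" and X: "X \<in> sets lebesgue"
    and h: "integrable (lebesgue_on X) h"
  shows "(\<integral>x. h x \<partial>lebesgue_on X) = (\<Sum>k\<le>K. \<integral>x. h x \<partial>lebesgue_on (B k))"
proof -
  have B: "B k \<in> sets lebesgue" "B k \<subseteq> X" if "k \<le> K" for k
    using part that by (auto simp: finite_measurable_partition_def)
  have "(\<integral>x. h x \<partial>lebesgue_on X) = (LINT x : (\<Union>k\<le>K. B k) | lebesgue. h x)"
    using part X by (simp add: integral_restrict_space set_lebesgue_integral_def finite_measurable_partition_def)
  also have "\<dots> = (\<Sum>k\<le>K. LINT x : B k | lebesgue. h x)"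
  proof (rule set_integral_finite_Union)
    show "disjoint_family_on B {..K}"
      using part by (simp add: finite_measurable_partition_def)
    fix k assume "k \<in> {..K}"
    then show "set_integrable lebesgue (B k) h" "B k \<in> sets lebesgue"
      using B[of k] integrable_lebesgue_on_subset[OF h X, of "B k"]
      by (simp_all add: integrable_restrict_space set_integrable_def)
  qed simp
  also have "\<dots> = (\<Sum>k\<le>K. \<integral>x. h x \<partial>lebesgue_on (B k))"
    using B by (intro sum.cong) (simp_all add: integral_restrict_space set_lebesgue_integral_def)
  finally show ?thesis .
qed

text \<open>Spreading \<open>\<phi> k\<close> over its bin turns the sum into an integral against
  \<open>f\<close>, so the difference is an average of \<open>\<phi> k - g x\<close> with total
  weight one. Closeness is asked only on bins of positive probability, because elsewhere the
  log-probability is \<open>ln 0\<close> and its derivatives carry no information.\<close>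

lemma bin_expectation_close:
  fixes g :: "'a::euclidean_space \<Rightarrow> 'v::euclidean_space"
  assumes part: "finite_measurable_partition X K B" and X: "X \<in> sets lebesgue"
    and f: "integrable (lebesgue_on X) f" "\<And>x. x \<in> X \<Longrightarrow> 0 \<le> f x" "(\<integral>x. f x \<partial>lebesgue_on X) = 1"
    and fg: "integrable (lebesgue_on X) (\<lambda>x. f x *\<^sub>R g x)"
    and close: "\<And>k x. k \<le> K \<Longrightarrow> 0 < (\<integral>x. f x \<partial>lebesgue_on (B k)) \<Longrightarrow> x \<in> B k \<Longrightarrow> norm (\<phi> k - g x) \<le> L"
  shows "norm ((\<Sum>k\<le>K. (\<integral>x. f x \<partial>lebesgue_on (B k)) *\<^sub>R \<phi> k) - (\<integral>x. f x *\<^sub>R g x \<partial>lebesgue_on X)) \<le> L"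
proof -
  let ?p = "\<lambda>k. \<integral>x. f x \<partial>lebesgue_on (B k)"
  have bin: "norm (?p k *\<^sub>R \<phi> k - (\<integral>x. f x *\<^sub>R g x \<partial>lebesgue_on (B k))) \<le> ?p k * L" if k: "k \<le> K" for k
  proof -
    have B: "B k \<in> sets lebesgue" "B k \<subseteq> X"
      using part k by (auto simp: finite_measurable_partition_def)
    have fk: "integrable (lebesgue_on (B k)) f"
      by (rule integrable_lebesgue_on_subset[OF f(1) X B])
    have fgk: "integrable (lebesgue_on (B k)) (\<lambda>x. f x *\<^sub>R g x)"
      by (rule integrable_lebesgue_on_subset[OF fg X B])
    have nonneg: "0 \<le> f x" if "x \<in> B k" for x using that B f(2) by auto
    have p_nonneg: "0 \<le> ?p k"
      by (rule Bochner_Integration.integral_nonneg) (use nonneg in auto)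
    show ?thesis
    proof (cases "?p k = 0")
      case True
      \<comment> \<open>On a bin of probability zero the density vanishes almost everywhere, so the
        bin contributes nothing to either expectation.\<close>
      then have "AE x in lebesgue_on (B k). f x = 0"
        using integral_nonneg_eq_0_iff_AE[OF fk AE_I2] nonneg by simp
      then have "(\<integral>x. f x *\<^sub>R g x \<partial>lebesgue_on (B k)) = 0"
        by (intro integral_eq_zero_AE) (auto elim: eventually_mono)
      then show ?thesis using True by simp
    next
      case False
      then have pos: "0 < ?p k" using p_nonneg by simp
      have "?p k *\<^sub>R \<phi> k - (\<integral>x. f x *\<^sub>R g x \<partial>lebesgue_on (B k))
            = (\<integral>x. f x *\<^sub>R \<phi> k - f x *\<^sub>R g x \<partial>lebesgue_on (B k))"
        using fk fgk by simp
      also have "norm \<dots> \<le> (\<integral>x. f x * L \<partial>lebesgue_on (B k))"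
      proof (rule norm_integral_le_integral)
        fix x assume "x \<in> space (lebesgue_on (B k))"
        then have x: "x \<in> B k" by simp
        show "norm (f x *\<^sub>R \<phi> k - f x *\<^sub>R g x) \<le> f x * L"
          using mult_left_mono[OF close[OF k pos x] nonneg[OF x]] nonneg[OF x]
          by (simp flip: scaleR_diff_right)
      qed (use fk fgk in auto)
      finally show ?thesis by simp
    qed
  qed
  have "(\<Sum>k\<le>K. ?p k *\<^sub>R \<phi> k) - (\<integral>x. f x *\<^sub>R g x \<partial>lebesgue_on X)
        = (\<Sum>k\<le>K. ?p k *\<^sub>R \<phi> k - (\<integral>x. f x *\<^sub>R g x \<partial>lebesgue_on (B k)))"
    by (simp add: integral_lebesgue_on_partition[OF part X fg] sum_subtractf)
  also have "norm \<dots> \<le> (\<Sum>k\<le>K. ?p k * L)"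
    by (rule sum_norm_le) (use bin in auto)
  also have "\<dots> = L"
    using integral_lebesgue_on_partition[OF part X f(1)] f(3) by (simp flip: sum_distrib_right)
  finally show ?thesis .
qed

section \<open>Elementary norm estimates\<close>

text \<open>Telescoping through \<open>c * b\<close>: each replacement costs its own error times a
  bound on the factor that is kept.\<close>

lemma mult_close:
  fixes a b c d :: real
  assumes "\<bar>a - c\<bar> \<le> \<delta>" "\<bar>b - d\<bar> \<le> \<delta>'" "\<bar>b\<bar> \<le> D" "\<bar>c\<bar> \<le> D'"
  shows "\<bar>a * b - c * d\<bar> \<le> \<delta> * D + D' * \<delta>'"
proof -
  have "a * b - c * d = (a - c) * b + c * (b - d)" by (simp add: algebra_simps)
  also have "\<bar>\<dots>\<bar> \<le> \<bar>a - c\<bar> * \<bar>b\<bar> + \<bar>c\<bar> * \<bar>b - d\<bar>"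
    using abs_triangle_ineq[of "(a - c) * b" "c * (b - d)"] by (simp add: abs_mult)
  also have "\<dots> \<le> \<delta> * D + D' * \<delta>'"
    using assms by (intro add_mono mult_mono) auto
  finally show ?thesis .
qed

lemma norm_cart_le:
  fixes v :: "'v::real_normed_vector ^ 'n"
  assumes "\<And>i. norm (v $ i) \<le> L"
  shows "norm v \<le> real CARD('n) * L"
proof -
  have "norm v \<le> (\<Sum>i\<in>UNIV. norm (v $ i))"
    unfolding norm_vec_def by (rule L2_set_le_sum) simp
  also have "\<dots> \<le> (\<Sum>i\<in>(UNIV :: 'n set). L)"
    by (intro sum_mono assms)
  finally show ?thesis by simp
qed

text \<open>The Euclidean norm dominates \<open>infnorm\<close>, and \<open>norm_cart_le\<close> is
  applied once per index. The dimension factors are wasteful, but constants do not affect the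
  rates.\<close>

lemma infnorm_matrix_le:
  fixes A :: "real ^ 'n ^ 'm"
  assumes "\<And>i j. \<bar>A $ i $ j\<bar> \<le> L"
  shows "infnorm A \<le> real CARD('m) * (real CARD('n) * L)"
  using infnorm_le_norm[of A] norm_cart_le[OF norm_cart_le, of A L] assms by fastforce

lemma infnorm_tensor_le:
  fixes A :: "real ^ 'n ^ 'm ^ 'l"
  assumes "\<And>i j k. \<bar>A $ i $ j $ k\<bar> \<le> L"
  shows "infnorm A \<le> real CARD('l) * (real CARD('m) * (real CARD('n) * L))"
  using infnorm_le_norm[of A] norm_cart_le[OF norm_cart_le[OF norm_cart_le], of A L] assms by fastforce

text \<open>Expansion in the standard basis gives the upper half of the equivalence of norms in
  finite dimension; \<open>c\<close> is the sum of \<open>N\<close> over the unit vectors.\<close>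

lemma is_norm_bounded:
  fixes N :: "real ^ 'p \<Rightarrow> real"
  assumes "is_norm N"
  obtains c where "\<And>x. 0 \<le> N x" "\<And>x. N x \<le> c * norm x"
proof -
  have scale: "N (a *\<^sub>R x) = \<bar>a\<bar> * N x" and tri: "N (x + y) \<le> N x + N y" and zero: "N 0 = 0" for a x y
    using assms by (auto simp: is_norm_def)
  have nonneg: "0 \<le> N x" for x
    using tri[of x "- x"] scale[of "-1" x] zero by simp
  have N_sum: "N (sum g I) \<le> (\<Sum>i\<in>I. N (g i))" if "finite I" for I :: "'p set" and g
    using that by (induction I rule: finite_induct) (auto simp: zero intro: order_trans[OF tri])
  have "N x \<le> (\<Sum>i\<in>UNIV. N (axis i 1)) * norm x" for x
  proof -
    have "N x = N (\<Sum>i\<in>UNIV. (x $ i) *\<^sub>R axis i 1)"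
      using basis_expansion[of x] by (simp add: scalar_mult_eq_scaleR)
    also have "\<dots> \<le> (\<Sum>i\<in>UNIV. \<bar>x $ i\<bar> * N (axis i 1))"
      using N_sum[of UNIV "\<lambda>i. (x $ i) *\<^sub>R axis i 1"] by (simp add: scale)
    also have "\<dots> \<le> (\<Sum>i\<in>UNIV. norm x * N (axis i 1))"
      by (intro sum_mono mult_right_mono component_le_norm_cart nonneg)
    finally show ?thesis by (simp add: sum_distrib_left mult.commute)
  qed
  then show ?thesis using that nonneg by blast
qed

section \<open>The discretised exponential family\<close>

text \<open>One fixed partition, with \<open>\<delta>\<close> bounding the oscillation of
  \<open>s\<close> on its bins. The error bounds obtained here involve \<open>\<delta>\<close>,
  \<open>C\<close>, the dimension and \<open>\<alpha>\<close>, but neither the parameter nor the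
  number of bins.\<close>

locale binned_exponential_family =
  fixes X :: "'a::euclidean_space set" and \<nu> :: "'a \<Rightarrow> real" and s :: "'a \<Rightarrow> real ^ 'p"
    and C :: real and K :: nat and B :: "nat \<Rightarrow> 'a set" and \<delta> :: real
  assumes X_sets: "X \<in> sets lebesgue"
    and tilt_X: "exponential_tilt (lebesgue_on X) \<nu> s C"
    and partition: "finite_measurable_partition X K B"
    and oscillation: "\<And>k x y. k \<le> K \<Longrightarrow> x \<in> B k \<Longrightarrow> y \<in> B k \<Longrightarrow> dist (s x) (s y) \<le> \<delta>"
begin

interpretation X: exponential_tilt "lebesgue_on X" \<nu> s C
  by (rule tilt_X)

abbreviation "f \<equiv> expfam_density X \<nu> s"
abbreviation "\<pi> \<equiv> bin_prob B f"
abbreviation "\<mu> \<equiv> tilt_mean (lebesgue_on X) \<nu> s"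
abbreviation "\<mu>\<^sub>B k \<equiv> tilt_mean (lebesgue_on (B k)) \<nu> s"
abbreviation "\<Sigma> \<equiv> tilt_cov (lebesgue_on X) \<nu> s"
abbreviation "\<Sigma>\<^sub>B k \<equiv> tilt_cov (lebesgue_on (B k)) \<nu> s"

lemma bin: "k \<le> K \<Longrightarrow> B k \<in> sets lebesgue" "k \<le> K \<Longrightarrow> B k \<subseteq> X"
  using partition by (auto simp: finite_measurable_partition_def)

lemma log_normaliser_eq: "log_normaliser X \<nu> s \<eta> = ln (tilt (lebesgue_on X) \<nu> s (\<lambda>_. 1) \<eta>)"
  by (simp add: log_normaliser_def tilt_def)

lemma density_eq: "f \<eta> x = \<nu> x * exp (\<eta> \<bullet> s x) / tilt (lebesgue_on X) \<nu> s (\<lambda>_. 1) \<eta>"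
  using X.tilt_one_pos[of \<eta>] by (simp add: expfam_density_def log_normaliser_eq exp_diff)

lemma density_nonneg: "x \<in> X \<Longrightarrow> 0 \<le> f \<eta> x"
  using X.nonneg[of x] by (simp add: expfam_density_def)

lemma integrable_density_mult:
  assumes "g \<in> borel_measurable (lebesgue_on X)" "\<And>x. x \<in> X \<Longrightarrow> \<bar>g x\<bar> \<le> D"
  shows "integrable (lebesgue_on X) (\<lambda>x. f \<eta> x * g x)"
  using integrable_divide[OF X.integrable_tilt[of g D \<eta>], of "tilt (lebesgue_on X) \<nu> s (\<lambda>_. 1) \<eta>"] assms
  by (simp add: density_eq mult_ac)

lemma integrable_density: "integrable (lebesgue_on X) (f \<eta>)"
  using integrable_density_mult[of "\<lambda>_. 1" 1 \<eta>] by simp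

lemma integral_density: "(\<integral>x. f \<eta> x \<partial>lebesgue_on X) = 1"
proof -
  have "(\<integral>x. f \<eta> x \<partial>lebesgue_on X)
      = tilt (lebesgue_on X) \<nu> s (\<lambda>_. 1) \<eta> / tilt (lebesgue_on X) \<nu> s (\<lambda>_. 1) \<eta>"
    by (simp add: density_eq tilt_def)
  then show ?thesis using X.tilt_one_pos[of \<eta>] by simp
qed

lemma bin_prob_eq:
  "\<pi> \<eta> k = tilt (lebesgue_on (B k)) \<nu> s (\<lambda>_. 1) \<eta> / tilt (lebesgue_on X) \<nu> s (\<lambda>_. 1) \<eta>"
  by (simp add: bin_prob_def density_eq tilt_def)

text \<open>Tilting only multiplies the base by a positive factor, so a bin with positive
  probability at one parameter has positive base mass. It then has positive probability at every
  parameter, and differentiation in the parameter never meets \<open>ln 0\<close>.\<close>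

lemma tilt_bin:
  assumes k: "k \<le> K" and pos: "0 < \<pi> \<theta> k"
  shows "exponential_tilt (lebesgue_on (B k)) \<nu> s C"
proof
  show nonneg: "0 \<le> \<nu> x" if "x \<in> space (lebesgue_on (B k))" for x
    using that bin[OF k] X.nonneg[of x] by auto
  show int: "integrable (lebesgue_on (B k)) \<nu>"
    by (rule integrable_lebesgue_on_subset[OF X.integrable_base X_sets bin[OF k]])
  show "s \<in> borel_measurable (lebesgue_on (B k))"
    using X.measurable_stat bin[OF k] by (blast intro: measurable_restrict_mono)
  show "norm (s x) \<le> C" if "x \<in> space (lebesgue_on (B k))" for x
    using that bin[OF k] X.bound[of x] by auto
  have "(\<integral>x. \<nu> x \<partial>lebesgue_on (B k)) \<noteq> 0"
  proof
    assume "(\<integral>x. \<nu> x \<partial>lebesgue_on (B k)) = 0"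
    then have "AE x in lebesgue_on (B k). \<nu> x = 0"
      using integral_nonneg_eq_0_iff_AE[OF int AE_I2] nonneg by simp
    then have "tilt (lebesgue_on (B k)) \<nu> s (\<lambda>_. 1) \<theta> = 0"
      unfolding tilt_def by (intro integral_eq_zero_AE) (auto elim: eventually_mono)
    then show False using pos by (simp add: bin_prob_eq)
  qed
  then show "0 < (\<integral>x. \<nu> x \<partial>lebesgue_on (B k))"
    using Bochner_Integration.integral_nonneg[of "lebesgue_on (B k)" \<nu>] nonneg by force
qed

section \<open>Scores of the two families and their derivatives\<close>

text \<open>Where \<open>\<nu>\<close> is positive, the log-density is affine in the parameter minus
  the log-normaliser, whose gradient is the mean of \<open>s\<close>.\<close>

lemma score:
  assumes "0 < \<nu> x"
  shows "partial r (loglik f x) \<eta> = s x $ r - \<mu> r \<eta>"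
proof -
  have "loglik f x \<eta>' = ln (\<nu> x) + \<eta>' \<bullet> s x - ln (tilt (lebesgue_on X) \<nu> s (\<lambda>_. 1) \<eta>')" for \<eta>'
    using assms by (simp add: loglik_def expfam_density_def log_normaliser_eq ln_mult)
  moreover have "((\<lambda>h. ln (\<nu> x) + (\<eta> + h *\<^sub>R axis r 1) \<bullet> s x
      - ln (tilt (lebesgue_on X) \<nu> s (\<lambda>_. 1) (\<eta> + h *\<^sub>R axis r 1))) has_real_derivative s x $ r - \<mu> r \<eta>) (at 0)"
    by (rule DERIV_diff[OF _ X.has_real_derivative_ln_tilt])
       (auto simp: inner_add_left inner_axis' intro!: derivative_eq_intros)
  ultimately show ?thesis
    unfolding partial_def by (simp add: DERIV_imp_deriv)
qed

lemma score_derivative: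
  assumes "0 < \<nu> x"
  shows "partial r (partial t (loglik f x)) \<eta> = - \<Sigma> r t \<eta>"
proof -
  have "((\<lambda>h. s x $ t - \<mu> t (\<eta> + h *\<^sub>R axis r 1)) has_real_derivative - \<Sigma> r t \<eta>) (at 0)"
    by (auto intro!: derivative_eq_intros X.has_real_derivative_tilt_mean)
  then show ?thesis
    \<comment> \<open>Only the outer derivative is unfolded. The inner one is rewritten by
      \<open>score\<close>, which holds at every parameter and hence under
      \<open>deriv\<close>.\<close>
    unfolding partial_def[of r] score[OF assms] by (rule DERIV_imp_deriv)
qed

text \<open>A bin probability is a quotient of two normalisers, so its logarithm is a difference of
  two log-normalisers, each having a mean as gradient. Positivity is asked at
  \<open>\<theta>\<close> while the formula holds at every \<open>\<eta>\<close>, so it can be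
  differentiated again.\<close>

lemma bin_score:
  assumes k: "k \<le> K" "0 < \<pi> \<theta> k"
  shows "partial r (loglik \<pi> k) \<eta> = \<mu>\<^sub>B k r \<eta> - \<mu> r \<eta>"
proof -
  interpret Bk: exponential_tilt "lebesgue_on (B k)" \<nu> s C by (rule tilt_bin[OF k])
  have "loglik \<pi> k \<eta>' = ln (tilt (lebesgue_on (B k)) \<nu> s (\<lambda>_. 1) \<eta>')
      - ln (tilt (lebesgue_on X) \<nu> s (\<lambda>_. 1) \<eta>')" for \<eta>'
    using Bk.tilt_one_pos[of \<eta>'] X.tilt_one_pos[of \<eta>'] by (simp add: loglik_def bin_prob_eq ln_div)
  moreover have "((\<lambda>h. ln (tilt (lebesgue_on (B k)) \<nu> s (\<lambda>_. 1) (\<eta> + h *\<^sub>R axis r 1))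
      - ln (tilt (lebesgue_on X) \<nu> s (\<lambda>_. 1) (\<eta> + h *\<^sub>R axis r 1)))
      has_real_derivative \<mu>\<^sub>B k r \<eta> - \<mu> r \<eta>) (at 0)"
    by (intro DERIV_diff Bk.has_real_derivative_ln_tilt X.has_real_derivative_ln_tilt)
  ultimately show ?thesis
    unfolding partial_def by (simp add: DERIV_imp_deriv)
qed

lemma bin_score_derivative:
  assumes k: "k \<le> K" "0 < \<pi> \<theta> k"
  shows "partial r (partial t (loglik \<pi> k)) \<eta> = \<Sigma>\<^sub>B k r t \<eta> - \<Sigma> r t \<eta>"
proof -
  interpret Bk: exponential_tilt "lebesgue_on (B k)" \<nu> s C by (rule tilt_bin[OF k])
  have "((\<lambda>h. \<mu>\<^sub>B k t (\<eta> + h *\<^sub>R axis r 1) - \<mu> t (\<eta> + h *\<^sub>R axis r 1))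
      has_real_derivative \<Sigma>\<^sub>B k r t \<eta> - \<Sigma> r t \<eta>) (at 0)"
    by (intro DERIV_diff Bk.has_real_derivative_tilt_mean X.has_real_derivative_tilt_mean)
  then show ?thesis
    unfolding partial_def[of r] bin_score[OF k] by (rule DERIV_imp_deriv)
qed

lemma comp_oscillation: "k \<le> K \<Longrightarrow> x \<in> B k \<Longrightarrow> y \<in> B k \<Longrightarrow> \<bar>s x $ r - s y $ r\<bar> \<le> \<delta>"
  using oscillation[of k x y] component_le_norm_cart[of "s x - s y" r] by (simp add: dist_norm)

lemma bin_mean_close:
  assumes k: "k \<le> K" "0 < \<pi> \<theta> k" and x: "x \<in> B k"
  shows "\<bar>\<mu>\<^sub>B k r \<eta> - s x $ r\<bar> \<le> \<delta>"
proof -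
  interpret Bk: exponential_tilt "lebesgue_on (B k)" \<nu> s C by (rule tilt_bin[OF k])
  show ?thesis by (rule Bk.tilt_mean_close) (use comp_oscillation[OF k(1) _ x] in auto)
qed

lemma bin_score_bound:
  assumes k: "k \<le> K" "0 < \<pi> \<theta> k"
  shows "\<bar>\<mu>\<^sub>B k r \<eta> - \<mu> r \<eta>\<bar> \<le> 2 * C"
proof -
  interpret Bk: exponential_tilt "lebesgue_on (B k)" \<nu> s C by (rule tilt_bin[OF k])
  show ?thesis using Bk.tilt_mean_bound[of r \<eta>] X.tilt_mean_bound[of r \<eta>] by linarith
qed

text \<open>The conditional covariance is the whole difference between the second derivatives of the
  two log-likelihoods; its smallness is what makes the connection coefficients close.\<close>

lemma bin_cov_bound:
  assumes k: "k \<le> K" "0 < \<pi> \<theta> k"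
  shows "\<bar>\<Sigma>\<^sub>B k r t \<eta>\<bar> \<le> \<delta> * C"
proof -
  interpret Bk: exponential_tilt "lebesgue_on (B k)" \<nu> s C by (rule tilt_bin[OF k])
  show ?thesis by (rule Bk.tilt_cov_bound) (use comp_oscillation[OF k(1)] in auto)
qed

lemma score_bound: "x \<in> X \<Longrightarrow> \<bar>s x $ r - \<mu> r \<eta>\<bar> \<le> 2 * C"
  using X.comp_bound[of x r] X.tilt_mean_bound[of r \<eta>] by simp

text \<open>Two values bounded by \<open>C\<close> differ by at most \<open>2 * C\<close>, which
  serves as the oscillation over all of \<open>X\<close>.\<close>

lemma cov_bound: "\<bar>\<Sigma> r t \<eta>\<bar> \<le> 2 * C * C"
proof (rule X.tilt_cov_bound)
  fix x y assume "x \<in> space (lebesgue_on X)" "y \<in> space (lebesgue_on X)"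
  then show "\<bar>s x $ r - s y $ r\<bar> \<le> 2 * C"
    using X.comp_bound[of x r] X.comp_bound[of y r] by linarith
qed

section \<open>Comparison of expectations under the two families\<close>

text \<open>The primed functions stand for the products of derivatives in the definitions, the
  unprimed ones for their closed forms, whose measurability and bounds are at hand. The two need to
  agree only where the weight is positive.\<close>

lemma expect_close:
  fixes g g' :: "'a \<Rightarrow> real" and \<phi> \<phi>' :: "nat \<Rightarrow> real"
  assumes g: "g \<in> borel_measurable (lebesgue_on X)" "\<And>x. x \<in> X \<Longrightarrow> \<bar>g x\<bar> \<le> D"
    and close: "\<And>k x. k \<le> K \<Longrightarrow> 0 < \<pi> \<theta> k \<Longrightarrow> x \<in> B k \<Longrightarrow> \<bar>\<phi> k - g x\<bar> \<le> L"
    and \<phi>: "\<And>k. k \<le> K \<Longrightarrow> 0 < \<pi> \<theta> k \<Longrightarrow> \<phi>' k = \<phi> k"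
    and g': "\<And>x. x \<in> X \<Longrightarrow> 0 < \<nu> x \<Longrightarrow> g' x = g x"
  shows "\<bar>expect (count_space {..K}) \<pi> \<theta> \<phi>' - expect (lebesgue_on X) f \<theta> g'\<bar> \<le> L"
proof -
  have "\<pi> \<theta> k *\<^sub>R \<phi>' k = \<pi> \<theta> k *\<^sub>R \<phi> k" if k: "k \<le> K" for k
  proof -
    have "0 \<le> \<pi> \<theta> k"
      unfolding bin_prob_def using bin[OF k] density_nonneg
      by (intro Bochner_Integration.integral_nonneg) auto
    then show ?thesis using \<phi>[OF k] by (cases "\<pi> \<theta> k = 0") auto
  qed
  then have "expect (count_space {..K}) \<pi> \<theta> \<phi>' = (\<Sum>k\<le>K. \<pi> \<theta> k *\<^sub>R \<phi> k)"
    unfolding expect_def lebesgue_integral_count_space_finite[OF finite_atMost]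
    by (intro sum.cong) auto
  moreover have "expect (lebesgue_on X) f \<theta> g' = (\<integral>x. f \<theta> x *\<^sub>R g x \<partial>lebesgue_on X)"
    unfolding expect_def
  proof (intro Bochner_Integration.integral_cong refl)
    fix x assume x: "x \<in> space (lebesgue_on X)"
    then show "f \<theta> x *\<^sub>R g' x = f \<theta> x *\<^sub>R g x"
      using X.nonneg[of x] g'[of x] by (cases "\<nu> x = 0") (auto simp: expfam_density_def)
  qed
  moreover have "norm ((\<Sum>k\<le>K. \<pi> \<theta> k *\<^sub>R \<phi> k) - (\<integral>x. f \<theta> x *\<^sub>R g x \<partial>lebesgue_on X)) \<le> L"
    unfolding bin_prob_def
    by (rule bin_expectation_close[OF partition X_sets integrable_density density_nonneg integral_density])
       (use close integrable_density_mult[OF g] in \<open>auto simp: bin_prob_def\<close>)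
  ultimately show ?thesis by simp
qed

text \<open>The only estimate in which labels occur: a label is a value of \<open>s\<close> on its
  own bin, hence within \<open>\<delta>\<close> of all other values there.\<close>

lemma mean_close:
  assumes lab: "\<And>k. k \<le> K \<Longrightarrow> lab k \<in> s ` B k"
  shows "norm ((\<Sum>k\<le>K. \<pi> \<theta> k *\<^sub>R lab k) - (\<integral>x. f \<theta> x *\<^sub>R s x \<partial>lebesgue_on X)) \<le> \<delta>"
  unfolding bin_prob_def
proof (rule bin_expectation_close[OF partition X_sets integrable_density density_nonneg integral_density])
  show "integrable (lebesgue_on X) (\<lambda>x. f \<theta> x *\<^sub>R s x)"
  proof (rule Bochner_Integration.integrable_bound)
    show "integrable (lebesgue_on X) (\<lambda>x. C * f \<theta> x)"
      using integrable_density by simp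
    show "(\<lambda>x. f \<theta> x *\<^sub>R s x) \<in> borel_measurable (lebesgue_on X)"
      using borel_measurable_integrable[OF integrable_density] X.measurable_stat by measurable
    show "AE x in lebesgue_on X. norm (f \<theta> x *\<^sub>R s x) \<le> norm (C * f \<theta> x)"
      using X.bound X.bound_nonneg density_nonneg
      by (intro AE_I2) (auto simp: abs_mult mult.commute intro!: mult_right_mono)
  qed
  fix k x assume "k \<le> K" "x \<in> B k"
  then show "norm (lab k - s x) \<le> \<delta>"
    using lab[of k] oscillation[of k _ x] by (auto simp: dist_norm)
qed auto

text \<open>The two factors are exchanged in turn, each exchange costing \<open>\<delta>\<close>
  times the bound \<open>2 * C\<close> of the other factor.\<close>

lemma fisher_entry_close:
  "\<bar>expect (count_space {..K}) \<pi> \<theta> (\<lambda>k. partial r (loglik \<pi> k) \<theta> * partial t (loglik \<pi> k) \<theta>)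
    - expect (lebesgue_on X) f \<theta> (\<lambda>x. partial r (loglik f x) \<theta> * partial t (loglik f x) \<theta>)\<bar>
   \<le> 4 * C * \<delta>"
proof (rule expect_close[where g = "\<lambda>x. (s x $ r - \<mu> r \<theta>) * (s x $ t - \<mu> t \<theta>)" and D = "(2 * C) * (2 * C)"
      and \<phi> = "\<lambda>k. (\<mu>\<^sub>B k r \<theta> - \<mu> r \<theta>) * (\<mu>\<^sub>B k t \<theta> - \<mu> t \<theta>)"])
  fix k x assume k: "k \<le> K" "0 < \<pi> \<theta> k" and x: "x \<in> B k"
  have "x \<in> X" using bin k x by auto
  then show "\<bar>(\<mu>\<^sub>B k r \<theta> - \<mu> r \<theta>) * (\<mu>\<^sub>B k t \<theta> - \<mu> t \<theta>) - (s x $ r - \<mu> r \<theta>) * (s x $ t - \<mu> t \<theta>)\<bar> \<le> 4 * C * \<delta>"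
    using mult_close[OF _ _ bin_score_bound[OF k, of t \<theta>] score_bound[of x r \<theta>],
        of "\<mu>\<^sub>B k r \<theta> - \<mu> r \<theta>" \<delta> "s x $ t - \<mu> t \<theta>" \<delta>]
      bin_mean_close[OF k x, of r \<theta>] bin_mean_close[OF k x, of t \<theta>]
    by (simp add: algebra_simps)
next
  fix x assume "x \<in> X"
  then show "\<bar>(s x $ r - \<mu> r \<theta>) * (s x $ t - \<mu> t \<theta>)\<bar> \<le> (2 * C) * (2 * C)"
    unfolding abs_mult using X.bound_nonneg by (intro mult_mono score_bound) auto
next
  show "(\<lambda>x. (s x $ r - \<mu> r \<theta>) * (s x $ t - \<mu> t \<theta>)) \<in> borel_measurable (lebesgue_on X)"
    using X.comp_measurable by measurable
qed (simp_all add: score bin_score)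

text \<open>Exchanging the first two factors costs \<open>4 * C * \<delta>\<close>, multiplied by
  the bound \<open>2 * C\<close> of the third; exchanging the third costs \<open>\<delta>\<close>
  times \<open>4 * C * C\<close>.\<close>

lemma skewness_entry_close:
  "\<bar>expect (count_space {..K}) \<pi> \<theta>
      (\<lambda>k. partial r (loglik \<pi> k) \<theta> * partial t (loglik \<pi> k) \<theta> * partial u (loglik \<pi> k) \<theta>)
    - expect (lebesgue_on X) f \<theta>
      (\<lambda>x. partial r (loglik f x) \<theta> * partial t (loglik f x) \<theta> * partial u (loglik f x) \<theta>)\<bar>
   \<le> 12 * C * C * \<delta>"
proof (rule expect_close[where
      g = "\<lambda>x. (s x $ r - \<mu> r \<theta>) * (s x $ t - \<mu> t \<theta>) * (s x $ u - \<mu> u \<theta>)" and D = "(2 * C) * (2 * C) * (2 * C)"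
      and \<phi> = "\<lambda>k. (\<mu>\<^sub>B k r \<theta> - \<mu> r \<theta>) * (\<mu>\<^sub>B k t \<theta> - \<mu> t \<theta>) * (\<mu>\<^sub>B k u \<theta> - \<mu> u \<theta>)"])
  fix k x assume k: "k \<le> K" "0 < \<pi> \<theta> k" and x: "x \<in> B k"
  have xX: "x \<in> X" using bin k x by auto
  have "\<bar>(\<mu>\<^sub>B k r \<theta> - \<mu> r \<theta>) * (\<mu>\<^sub>B k t \<theta> - \<mu> t \<theta>) - (s x $ r - \<mu> r \<theta>) * (s x $ t - \<mu> t \<theta>)\<bar> \<le> \<delta> * (2 * C) + (2 * C) * \<delta>"
    by (rule mult_close)
       (use bin_score_bound[OF k, of t \<theta>] score_bound[OF xX, of r \<theta>]
         bin_mean_close[OF k x, of r \<theta>] bin_mean_close[OF k x, of t \<theta>] in auto)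
  moreover have "\<bar>(s x $ r - \<mu> r \<theta>) * (s x $ t - \<mu> t \<theta>)\<bar> \<le> (2 * C) * (2 * C)"
    unfolding abs_mult using X.bound_nonneg xX by (intro mult_mono score_bound) auto
  ultimately have "\<bar>(\<mu>\<^sub>B k r \<theta> - \<mu> r \<theta>) * (\<mu>\<^sub>B k t \<theta> - \<mu> t \<theta>) * (\<mu>\<^sub>B k u \<theta> - \<mu> u \<theta>)
        - (s x $ r - \<mu> r \<theta>) * (s x $ t - \<mu> t \<theta>) * (s x $ u - \<mu> u \<theta>)\<bar>
      \<le> (\<delta> * (2 * C) + (2 * C) * \<delta>) * (2 * C) + (2 * C) * (2 * C) * \<delta>"
    by - (rule mult_close, use bin_score_bound[OF k, of u \<theta>] bin_mean_close[OF k x, of u \<theta>] in auto)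
  then show "\<bar>(\<mu>\<^sub>B k r \<theta> - \<mu> r \<theta>) * (\<mu>\<^sub>B k t \<theta> - \<mu> t \<theta>) * (\<mu>\<^sub>B k u \<theta> - \<mu> u \<theta>)
        - (s x $ r - \<mu> r \<theta>) * (s x $ t - \<mu> t \<theta>) * (s x $ u - \<mu> u \<theta>)\<bar> \<le> 12 * C * C * \<delta>"
    by (simp add: algebra_simps)
next
  fix x assume "x \<in> X"
  then show "\<bar>(s x $ r - \<mu> r \<theta>) * (s x $ t - \<mu> t \<theta>) * (s x $ u - \<mu> u \<theta>)\<bar> \<le> (2 * C) * (2 * C) * (2 * C)"
    unfolding abs_mult using X.bound_nonneg by (intro mult_mono score_bound) auto
next
  show "(\<lambda>x. (s x $ r - \<mu> r \<theta>) * (s x $ t - \<mu> t \<theta>) * (s x $ u - \<mu> u \<theta>)) \<in> borel_measurable (lebesgue_on X)"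
    using X.comp_measurable by measurable
qed (simp_all add: score bin_score)

text \<open>Where \<open>\<nu>\<close> is positive, the second derivative of the log-density is
  \<open>- \<Sigma> r t \<theta>\<close>, independent of the point. On a bin it is therefore missed
  only by the conditional covariance, at most \<open>\<delta> * C\<close>. Each of the two exchanges
  costs \<open>2 * C * C * \<delta>\<close>.\<close>

lemma connection_entry_close:
  "\<bar>expect (count_space {..K}) \<pi> \<theta> (\<lambda>k. partial r (partial t (loglik \<pi> k)) \<theta> * partial u (loglik \<pi> k) \<theta>)
    - expect (lebesgue_on X) f \<theta> (\<lambda>x. partial r (partial t (loglik f x)) \<theta> * partial u (loglik f x) \<theta>)\<bar>
   \<le> 4 * C * C * \<delta>"
proof (rule expect_close[where g = "\<lambda>x. - \<Sigma> r t \<theta> * (s x $ u - \<mu> u \<theta>)" and D = "(2 * C * C) * (2 * C)"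
      and \<phi> = "\<lambda>k. (\<Sigma>\<^sub>B k r t \<theta> - \<Sigma> r t \<theta>) * (\<mu>\<^sub>B k u \<theta> - \<mu> u \<theta>)"])
  fix k x assume k: "k \<le> K" "0 < \<pi> \<theta> k" and x: "x \<in> B k"
  have "\<bar>(\<Sigma>\<^sub>B k r t \<theta> - \<Sigma> r t \<theta>) * (\<mu>\<^sub>B k u \<theta> - \<mu> u \<theta>) - (- \<Sigma> r t \<theta>) * (s x $ u - \<mu> u \<theta>)\<bar>
      \<le> (\<delta> * C) * (2 * C) + (2 * C * C) * \<delta>"
    by (rule mult_close)
       (use bin_cov_bound[OF k, of r t \<theta>] bin_score_bound[OF k, of u \<theta>] cov_bound[of r t \<theta>]
         bin_mean_close[OF k x, of u \<theta>] in auto)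
  then show "\<bar>(\<Sigma>\<^sub>B k r t \<theta> - \<Sigma> r t \<theta>) * (\<mu>\<^sub>B k u \<theta> - \<mu> u \<theta>) - - \<Sigma> r t \<theta> * (s x $ u - \<mu> u \<theta>)\<bar> \<le> 4 * C * C * \<delta>"
    by (simp add: algebra_simps)
next
  fix x assume "x \<in> X"
  then show "\<bar>- \<Sigma> r t \<theta> * (s x $ u - \<mu> u \<theta>)\<bar> \<le> (2 * C * C) * (2 * C)"
    unfolding abs_mult using X.bound_nonneg cov_bound[of r t \<theta>] by (intro mult_mono score_bound) auto
next
  show "(\<lambda>x. - \<Sigma> r t \<theta> * (s x $ u - \<mu> u \<theta>)) \<in> borel_measurable (lebesgue_on X)"
    using X.comp_measurable by measurable
qed (simp_all add: score bin_score score_derivative bin_score_derivative)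

lemma fisher_close:
  "infnorm (fisher_information (count_space {..K}) \<pi> \<theta> - fisher_information (lebesgue_on X) f \<theta>)
   \<le> real CARD('p) * (real CARD('p) * (4 * C * \<delta>))"
  by (rule infnorm_matrix_le) (simp add: fisher_information_def fisher_entry_close)

lemma skewness_close:
  "infnorm (skewness_tensor (count_space {..K}) \<pi> \<theta> - skewness_tensor (lebesgue_on X) f \<theta>)
   \<le> real CARD('p) * (real CARD('p) * (real CARD('p) * (12 * C * C * \<delta>)))"
  by (rule infnorm_tensor_le) (simp add: skewness_tensor_def skewness_entry_close)

lemma alpha_connection_close:
  "infnorm (alpha_connection \<alpha> (count_space {..K}) \<pi> \<theta> - alpha_connection \<alpha> (lebesgue_on X) f \<theta>)
   \<le> real CARD('p) * (real CARD('p) * (real CARD('p) *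
       (4 * C * C * \<delta> + \<bar>(1 - \<alpha>) / 2\<bar> * (12 * C * C * \<delta>))))"
proof (rule infnorm_tensor_le)
  fix r t u :: 'p
  let ?S = "\<lambda>M p. skewness_tensor M p \<theta> $ r $ t $ u"
    and ?E = "\<lambda>M p. expect M p \<theta> (\<lambda>x. partial r (partial t (loglik p x)) \<theta> * partial u (loglik p x) \<theta>)"
  have skewness: "\<bar>?S (count_space {..K}) \<pi> - ?S (lebesgue_on X) f\<bar> \<le> 12 * C * C * \<delta>"
    using skewness_entry_close[of \<theta> r t u] by (simp add: skewness_tensor_def)
  have entry: "(alpha_connection \<alpha> (count_space {..K}) \<pi> \<theta> - alpha_connection \<alpha> (lebesgue_on X) f \<theta>) $ r $ t $ u
      = (?E (count_space {..K}) \<pi> - ?E (lebesgue_on X) f)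
        + (1 - \<alpha>) / 2 * (?S (count_space {..K}) \<pi> - ?S (lebesgue_on X) f)"
    by (simp add: alpha_connection_def right_diff_distrib)
  have "\<bar>?E (count_space {..K}) \<pi> - ?E (lebesgue_on X) f\<bar>
        + \<bar>(1 - \<alpha>) / 2\<bar> * \<bar>?S (count_space {..K}) \<pi> - ?S (lebesgue_on X) f\<bar>
      \<le> 4 * C * C * \<delta> + \<bar>(1 - \<alpha>) / 2\<bar> * (12 * C * C * \<delta>)"
    by (rule add_mono[OF connection_entry_close[of \<theta> r t u] mult_left_mono[OF skewness abs_ge_zero]])
  then show "\<bar>(alpha_connection \<alpha> (count_space {..K}) \<pi> \<theta> - alpha_connection \<alpha> (lebesgue_on X) f \<theta>) $ r $ t $ u\<bar>
      \<le> 4 * C * C * \<delta> + \<bar>(1 - \<alpha>) / 2\<bar> * (12 * C * C * \<delta>)"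
    unfolding entry abs_mult[symmetric] by (rule order_trans[OF abs_triangle_ineq])
qed

end

section \<open>From the hypotheses on the family to the rates\<close>

text \<open>As \<open>s\<close> is bounded, the exponential factor at \<open>\<theta>\<close> is
  bounded below by a positive constant, so integrability passes from the density back to
  \<open>\<nu>\<close>. Since the density has integral one, \<open>\<nu>\<close> cannot vanish
  almost everywhere.\<close>

lemma exponential_family_tilt:
  fixes s :: "'a::euclidean_space \<Rightarrow> real ^ 'p"
  assumes fam: "exponential_family X \<Theta> \<nu> s" and \<theta>: "\<theta> \<in> \<Theta>"
    and bd: "\<And>x. x \<in> X \<Longrightarrow> norm (s x) \<le> C"
  shows "exponential_tilt (lebesgue_on X) \<nu> s C"
proof
  have nu_meas [measurable]: "\<nu> \<in> borel_measurable (lebesgue_on X)"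
    and int: "integrable (lebesgue_on X) (expfam_density X \<nu> s \<theta>)"
    and one: "(\<integral>x. expfam_density X \<nu> s \<theta> x \<partial>lebesgue_on X) = 1"
    using fam \<theta> by (auto simp: exponential_family_def)
  show nonneg: "0 \<le> \<nu> x" if "x \<in> space (lebesgue_on X)" for x
    using that fam by (simp add: exponential_family_def)
  show "s \<in> borel_measurable (lebesgue_on X)"
    using fam by (simp add: exponential_family_def)
  show "norm (s x) \<le> C" if "x \<in> space (lebesgue_on X)" for x
    using that bd by simp
  define \<psi> where "\<psi> = log_normaliser X \<nu> s \<theta>"
  show int_nu: "integrable (lebesgue_on X) \<nu>"
  proof (rule Bochner_Integration.integrable_bound)
    show "integrable (lebesgue_on X) (\<lambda>x. exp (norm \<theta> * C + \<psi>) * expfam_density X \<nu> s \<theta> x)"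
      using int by simp
    show "AE x in lebesgue_on X. norm (\<nu> x) \<le> norm (exp (norm \<theta> * C + \<psi>) * expfam_density X \<nu> s \<theta> x)"
    proof (rule AE_I2)
      fix x assume x: "x \<in> space (lebesgue_on X)"
      have "\<bar>\<theta> \<bullet> s x\<bar> \<le> norm \<theta> * C"
        using Cauchy_Schwarz_ineq2[of \<theta> "s x"] mult_left_mono[OF bd[of x], of "norm \<theta>"] x by force
      then have "1 \<le> exp (norm \<theta> * C + \<psi>) * exp (\<theta> \<bullet> s x - \<psi>)"
        by (simp flip: exp_add)
      from mult_left_mono[OF this nonneg[OF x]]
      show "norm (\<nu> x) \<le> norm (exp (norm \<theta> * C + \<psi>) * expfam_density X \<nu> s \<theta> x)"
        using nonneg[OF x] by (simp add: expfam_density_def \<psi>_def abs_mult mult_ac)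
    qed
  qed measurable
  have "(\<integral>x. \<nu> x \<partial>lebesgue_on X) \<noteq> 0"
  proof
    assume "(\<integral>x. \<nu> x \<partial>lebesgue_on X) = 0"
    then have "AE x in lebesgue_on X. \<nu> x = 0"
      using integral_nonneg_eq_0_iff_AE[OF int_nu AE_I2] nonneg by simp
    then have "(\<integral>x. expfam_density X \<nu> s \<theta> x \<partial>lebesgue_on X) = 0"
      unfolding expfam_density_def by (intro integral_eq_zero_AE) (auto elim: eventually_mono)
    then show False using one by simp
  qed
  then show "0 < (\<integral>x. \<nu> x \<partial>lebesgue_on X)"
    using Bochner_Integration.integral_nonneg[of "lebesgue_on X" \<nu>] nonneg by force
qed

text \<open>Below 1 a higher power is the smaller one, so a single cubic bound serves the rates of
  order one, two and three.\<close>

lemma bigo_power_at_right_0: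
  fixes g :: "real \<Rightarrow> real"
  assumes "\<And>\<epsilon>. 0 < \<epsilon> \<Longrightarrow> 0 \<le> g \<epsilon>" "\<And>\<epsilon>. 0 < \<epsilon> \<Longrightarrow> g \<epsilon> \<le> c * \<epsilon> ^ m" and "n \<le> m"
  shows "g \<in> O[at_right 0](\<lambda>\<epsilon>. \<epsilon> ^ n)"
proof (rule bigoI)
  show "\<forall>\<^sub>F \<epsilon> in at_right 0. norm (g \<epsilon>) \<le> \<bar>c\<bar> * norm (\<epsilon> ^ n)"
    unfolding eventually_at_right_field
  proof (intro exI[of _ 1] conjI allI impI)
    fix \<epsilon> :: real assume \<epsilon>: "0 < \<epsilon>" "\<epsilon> < 1"
    have "g \<epsilon> \<le> \<bar>c\<bar> * \<epsilon> ^ m"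
      using \<epsilon> by (intro order_trans[OF assms(2) mult_right_mono[OF abs_ge_self]]) auto
    also have "\<dots> \<le> \<bar>c\<bar> * \<epsilon> ^ n"
      using \<epsilon> \<open>n \<le> m\<close> by (intro mult_left_mono power_decreasing) auto
    finally show "norm (g \<epsilon>) \<le> \<bar>c\<bar> * norm (\<epsilon> ^ n)"
      using assms(1)[OF \<epsilon>(1)] \<epsilon> by simp
  qed simp
qed

theorem theorem4p2:
  fixes X :: "'a::euclidean_space set"
    and \<Theta> :: "(real ^ 'p) set"
    and \<nu> :: "'a \<Rightarrow> real"
    and s :: "'a \<Rightarrow> real ^ 'p"
    and f :: "real ^ 'p \<Rightarrow> 'a \<Rightarrow> real"
  defines "f \<equiv> expfam_density X \<nu> s"
  assumes "exponential_family X \<Theta> \<nu> s"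
    and "amari_regular (lebesgue_on X) \<Theta> f"
    and "uniformly_continuous_on X s"
    and "compact (s ` X)"
  shows "\<exists>(K :: real \<Rightarrow> nat) (B :: real \<Rightarrow> nat \<Rightarrow> 'a set).
    (\<forall>\<epsilon>>0. finite_measurable_partition X (K \<epsilon>) (B \<epsilon>)) \<and>
    (\<forall>lab :: real \<Rightarrow> nat \<Rightarrow> real ^ 'p. (\<forall>\<epsilon>>0. \<forall>k\<le>K \<epsilon>. lab \<epsilon> k \<in> s ` B \<epsilon> k) \<longrightarrow>
      (\<forall>\<theta>\<in>\<Theta>.
        (\<forall>N. is_norm N \<longrightarrow>
          (\<lambda>\<epsilon>. N ((\<Sum>k\<le>K \<epsilon>. bin_prob (B \<epsilon>) f \<theta> k *\<^sub>R lab \<epsilon> k)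
                  - (\<integral>x. f \<theta> x *\<^sub>R s x \<partial>lebesgue_on X)))
            \<in> O[at_right 0](\<lambda>\<epsilon>. \<epsilon>)) \<and>
        (\<lambda>\<epsilon>. infnorm (fisher_information (count_space {..K \<epsilon>}) (bin_prob (B \<epsilon>) f) \<theta>
                       - fisher_information (lebesgue_on X) f \<theta>))
          \<in> O[at_right 0](\<lambda>\<epsilon>. \<epsilon> ^ 2) \<and>
        (\<lambda>\<epsilon>. infnorm (skewness_tensor (count_space {..K \<epsilon>}) (bin_prob (B \<epsilon>) f) \<theta>
                       - skewness_tensor (lebesgue_on X) f \<theta>))
          \<in> O[at_right 0](\<lambda>\<epsilon>. \<epsilon> ^ 3) \<and>
        (\<forall>\<alpha>::real.
          (\<lambda>\<epsilon>. infnorm (alpha_connection \<alpha> (count_space {..K \<epsilon>}) (bin_prob (B \<epsilon>) f) \<theta>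
                         - alpha_connection \<alpha> (lebesgue_on X) f \<theta>))
            \<in> O[at_right 0](\<lambda>\<epsilon>. \<epsilon>))))"
proof -
  have X: "X \<in> sets lebesgue" "X \<noteq> {}" "s \<in> borel_measurable (lebesgue_on X)"
    using assms(2) by (auto simp: exponential_family_def)
  obtain C where C: "\<And>x. x \<in> X \<Longrightarrow> norm (s x) \<le> C"
    using compact_imp_bounded[OF \<open>compact (s ` X)\<close>] by (auto simp: bounded_iff)
  have "\<exists>K B. finite_measurable_partition X K B \<and>
      (\<forall>k\<le>K. \<forall>x\<in>B k. \<forall>y\<in>B k. dist (s x) (s y) \<le> \<epsilon> ^ 3)" if "0 < \<epsilon>" for \<epsilon> :: real
    using small_image_partition[OF X \<open>compact (s ` X)\<close>, of "\<epsilon> ^ 3"] that by (metis zero_less_power)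
  \<comment> \<open>The choice is made for each \<open>\<epsilon>\<close> alone, before labels,
    parameter, norm and \<open>\<alpha>\<close> are given, as the order of the quantifiers
    demands.\<close>
  then obtain K B where part: "\<And>\<epsilon>. 0 < \<epsilon> \<Longrightarrow> finite_measurable_partition X (K \<epsilon>) (B \<epsilon>)"
    and osc: "\<And>\<epsilon> k x y. 0 < \<epsilon> \<Longrightarrow> k \<le> K \<epsilon> \<Longrightarrow> x \<in> B \<epsilon> k \<Longrightarrow> y \<in> B \<epsilon> k \<Longrightarrow> dist (s x) (s y) \<le> \<epsilon> ^ 3"
    by metis
  \<comment> \<open>The point of \<open>\<Theta>\<close> supplies the normalisation from which the
    base is seen to be integrable; none of \<open>C\<close>, \<open>K\<close> and \<open>B\<close>
    depends on it.\<close>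
  have family: "binned_exponential_family X \<nu> s C (K \<epsilon>) (B \<epsilon>) (\<epsilon> ^ 3)" if "0 < \<epsilon>" "\<theta> \<in> \<Theta>" for \<epsilon> \<theta>
    using exponential_family_tilt[OF assms(2) that(2) C] X(1) part[OF that(1)] osc[OF that(1)]
    by (intro binned_exponential_family.intro) auto
  note close = binned_exponential_family.mean_close[OF family]
    binned_exponential_family.fisher_close[OF family]
    binned_exponential_family.skewness_close[OF family]
    binned_exponential_family.alpha_connection_close[OF family]
  show ?thesis
    unfolding f_def
  proof (intro exI[of _ K] exI[of _ B] conjI allI impI ballI)
    show "finite_measurable_partition X (K \<epsilon>) (B \<epsilon>)" if "0 < \<epsilon>" for \<epsilon>
      using part[OF that] .
  next
    fix lab \<theta> and N :: "real ^ 'p \<Rightarrow> real"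
    assume lab: "\<forall>\<epsilon>>0. \<forall>k\<le>K \<epsilon>. lab \<epsilon> k \<in> s ` B \<epsilon> k" and \<theta>: "\<theta> \<in> \<Theta>" and N: "is_norm N"
    obtain c where c: "\<And>x. 0 \<le> N x" "\<And>x. N x \<le> c * norm x"
      using is_norm_bounded[OF N] by blast
    let ?d = "\<lambda>\<epsilon>. (\<Sum>k\<le>K \<epsilon>. bin_prob (B \<epsilon>) (expfam_density X \<nu> s) \<theta> k *\<^sub>R lab \<epsilon> k)
                  - (\<integral>x. expfam_density X \<nu> s \<theta> x *\<^sub>R s x \<partial>lebesgue_on X)"
    \<comment> \<open>The constant from \<open>is_norm_bounded\<close> comes without a sign, hence
      its absolute value below. The exponent 1 is written out to match
      \<open>bigo_power_at_right_0\<close>.\<close>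
    have "(\<lambda>\<epsilon>. N (?d \<epsilon>)) \<in> O[at_right 0](\<lambda>\<epsilon>. \<epsilon> ^ 1)"
    proof (rule bigo_power_at_right_0[where m = 3 and c = "\<bar>c\<bar>"])
      fix \<epsilon> :: real assume \<epsilon>: "0 < \<epsilon>"
      have "N (?d \<epsilon>) \<le> \<bar>c\<bar> * norm (?d \<epsilon>)"
        by (rule order_trans[OF c(2) mult_right_mono[OF abs_ge_self norm_ge_zero]])
      also have "\<dots> \<le> \<bar>c\<bar> * \<epsilon> ^ 3"
        using close(1)[OF \<epsilon> \<theta>] lab \<epsilon> by (intro mult_left_mono) auto
      finally show "N (?d \<epsilon>) \<le> \<bar>c\<bar> * \<epsilon> ^ 3" .
    qed (use c(1) in auto)
    then show "(\<lambda>\<epsilon>. N (?d \<epsilon>)) \<in> O[at_right 0](\<lambda>\<epsilon>. \<epsilon>)" by simp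
  next
    fix \<theta> assume \<theta>: "\<theta> \<in> \<Theta>"
    show "(\<lambda>\<epsilon>. infnorm (fisher_information (count_space {..K \<epsilon>}) (bin_prob (B \<epsilon>) (expfam_density X \<nu> s)) \<theta>
                       - fisher_information (lebesgue_on X) (expfam_density X \<nu> s) \<theta>))
          \<in> O[at_right 0](\<lambda>\<epsilon>. \<epsilon> ^ 2)"
      by (rule bigo_power_at_right_0[where m = 3 and c = "real CARD('p) * (real CARD('p) * (4 * C))"])
         (use close(2)[OF _ \<theta>] in \<open>auto simp: infnorm_pos_le mult_ac\<close>)
    show "(\<lambda>\<epsilon>. infnorm (skewness_tensor (count_space {..K \<epsilon>}) (bin_prob (B \<epsilon>) (expfam_density X \<nu> s)) \<theta>
                       - skewness_tensor (lebesgue_on X) (expfam_density X \<nu> s) \<theta>))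
          \<in> O[at_right 0](\<lambda>\<epsilon>. \<epsilon> ^ 3)"
      by (rule bigo_power_at_right_0[where m = 3 and
            c = "real CARD('p) * (real CARD('p) * (real CARD('p) * (12 * C * C)))"])
         (use close(3)[OF _ \<theta>] in \<open>auto simp: infnorm_pos_le mult_ac\<close>)
    fix \<alpha> :: real
    have "(\<lambda>\<epsilon>. infnorm (alpha_connection \<alpha> (count_space {..K \<epsilon>}) (bin_prob (B \<epsilon>) (expfam_density X \<nu> s)) \<theta>
                         - alpha_connection \<alpha> (lebesgue_on X) (expfam_density X \<nu> s) \<theta>))
          \<in> O[at_right 0](\<lambda>\<epsilon>. \<epsilon> ^ 1)"
      by (rule bigo_power_at_right_0[where m = 3 and c = "real CARD('p) * (real CARD('p) * (real CARD('p) *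
            (4 * C * C + \<bar>(1 - \<alpha>) / 2\<bar> * (12 * C * C))))"])
         (use close(4)[OF _ \<theta>, of _ \<alpha>] in \<open>auto simp: infnorm_pos_le algebra_simps\<close>)
    then show "(\<lambda>\<epsilon>. infnorm (alpha_connection \<alpha> (count_space {..K \<epsilon>}) (bin_prob (B \<epsilon>) (expfam_density X \<nu> s)) \<theta>
                         - alpha_connection \<alpha> (lebesgue_on X) (expfam_density X \<nu> s) \<theta>))
          \<in> O[at_right 0](\<lambda>\<epsilon>. \<epsilon>)" by simp
  qed
qed

end
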